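(* Let $p,q\in\mathbb{N}$ (positive integers) and let $m\ge2$ be an even integer. The $(0,p/q)$-generalized Fourier transform $\mathcal{F}_{p/q}$ is well-defined on $B_{p/q}(\mathbb{R}^m)$ (i.e. for every $f\in B_{p/q}(\mathbb{R}^m)$ the integral defining $\mathcal{F}_{p/q}[f](y)$ converges absolutely for every $y\in\mathbb{R}^m$). In particular, for $f\in B_{p/q}(\mathbb{R}^m)$, $\mathcal{F}_{p/q}f$ is a continuous function.
   Context: For an integer $m\ge2$ put $\lambda=(m-2)/2$. Let $a>0$. For $x,y\in\mathbb{R}^m\setminus\{0\}$ put $z=|x||y|$, $\xi=\langle x,y\rangle/z=\cos\theta$ with $\theta\in[0,\pi]$. For $m\ge3$ the radially deformed Fourier kernel is $$K_a^m(x,y)=a^{2\lambda/a}\,\Gamma\left(\frac{2\lambda+a}{a}\right)\sum_{k=0}^{\infty}e^{-\frac{i\pi k}{a}}\frac{\lambda+k}{\lambda}z^{-\lambda}J_{\frac{2(k+\lambda)}{a}}\left(\frac{2}{a}z^{a/2}\right)C_k^{(\lambda)}(\xi),$$ and for $m=2$ it is the limit $\lambda\to0$, namely $K_a^2(x,y)=J_0(z_a)+2\sum_{k=1}^{\infty}e^{-\frac{i\pi k}{a}}J_{\frac{2k}{a}}(z_a)\cos k\theta$ with $z_a=\frac2a z^{a/2}$. Here $J_\nu$ is the Bessel function of the first kind and $C_k^{(\lambda)}$ is the Gegenbauer polynomial. If $x=0$ or $y=0$ the kernel is defined by continuity and equals $1$. The $(0,a)$-generalized (radially deformed) Fourier transform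 is the integral transform $$\mathcal{F}_a[f](y)=\frac{\Gamma(m/2)}{\Gamma\left(\frac{2\lambda+a}{a}\right)2a^{2\lambda/a}\pi^{m/2}}\int_{\mathbb{R}^m}K_a^m(x,y)f(x)|x|^{a-2}\,dx.$$ The function class is $$B_{p/q}(\mathbb{R}^m)=\left\{f\in L^1(\mathbb{R}^m):\int_{\mathbb{R}^m}(1+|x|)^{\frac{3mp}{2}-m+2}|f(x)||x|^{p/q-2}\,dx<\infty\right\}.$$ *)

theory Defs
  imports "HOL-Analysis.Analysis"
begin

text \<open>
  Bessel function of the first kind of real order, as the series
  \<open>\<Sum>j. (-1)^j / (j! \<Gamma>(j + \<nu> + 1)) (w/2)^(2j + \<nu>)\<close>.
  It is meant for \<open>w > 0\<close>, and the kernel below only evaluates it there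
  (at \<open>w = 0\<close>, \<open>\<nu> = 0\<close> the convention \<open>0 powr 0 = 0\<close> would give the wrong value).
  The function \<open>rGamma\<close> is the reciprocal of \<open>Gamma\<close>.
\<close>

definition bessel_J :: "real \<Rightarrow> real \<Rightarrow> real" where
  "bessel_J \<nu> w =
     (\<Sum>j. (-1) ^ j / fact j * rGamma (real j + \<nu> + 1) * (w / 2) powr (2 * real j + \<nu>))"

text \<open>
  For \<open>lam > 0\<close>, \<open>pochhammer lam (k - j) = \<Gamma>(k - j + lam) / \<Gamma>(lam)\<close>, so this is the usual explicit
  form of the Gegenbauer polynomial, with generating function \<open>(1 - 2 t s + s^2)^(-lam)\<close>.
\<close>

definition gegenbauer :: "nat \<Rightarrow> real \<Rightarrow> real \<Rightarrow> real" where
  "gegenbauer k lam t =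
     (\<Sum>j\<le>k div 2. (-1) ^ j * pochhammer lam (k - j) / (fact j * fact (k - 2 * j))
        * (2 * t) ^ (k - 2 * j))"

definition gegenbauer_index :: "'n::finite itself \<Rightarrow> real" where
  "gegenbauer_index _ = (real CARD('n) - 2) / 2"

text \<open>
  The dimension \<open>m\<close> is \<open>CARD('n)\<close>. In the second branch (\<open>m = 2\<close>) the sum over \<open>k \<ge> 1\<close> is indexed
  by \<open>Suc k\<close>. The last branch is the definition for \<open>m \<ge> 3\<close>; no meaning is
  attached to \<open>m = 1\<close>.
\<close>

definition deformed_kernel :: "real \<Rightarrow> real ^ 'n \<Rightarrow> real ^ 'n \<Rightarrow> complex" where
  "deformed_kernel a x y =
     (let lam = gegenbauer_index TYPE('n);
          z = norm x * norm y;
          \<xi> = inner x y / z;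
          \<theta> = arccos \<xi>;
          w = 2 / a * z powr (a / 2)
      in if x = 0 \<or> y = 0 then 1
         else if CARD('n) = 2 then
           complex_of_real (bessel_J 0 w)
           + 2 * (\<Sum>k. exp (- (\<i> * complex_of_real (pi * real (Suc k) / a)))
                    * complex_of_real (bessel_J (2 * real (Suc k) / a) w * cos (real (Suc k) * \<theta>)))
         else
           complex_of_real (a powr (2 * lam / a) * Gamma ((2 * lam + a) / a))
           * (\<Sum>k. exp (- (\<i> * complex_of_real (pi * real k / a)))
                * complex_of_real ((lam + real k) / lam * z powr (- lam)
                    * bessel_J (2 * (real k + lam) / a) w * gegenbauer k lam \<xi>)))"

text \<open>
  The value of \<open>norm x powr (a - 2)\<close> at \<open>x = 0\<close> (namely \<open>0\<close>, also for \<open>a \<le> 2\<close>) concerns only a null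
  set, here and in the class \<open>deformed_B\<close> below.
\<close>

definition deformed_integrand ::
    "real \<Rightarrow> (real ^ 'n \<Rightarrow> complex) \<Rightarrow> real ^ 'n \<Rightarrow> real ^ 'n \<Rightarrow> complex" where
  "deformed_integrand a f y x =
     deformed_kernel a x y * f x * complex_of_real (norm x powr (a - 2))"

definition deformed_fourier ::
    "real \<Rightarrow> (real ^ 'n \<Rightarrow> complex) \<Rightarrow> real ^ 'n \<Rightarrow> complex" where
  "deformed_fourier a f y =
     (let m = real CARD('n); lam = gegenbauer_index TYPE('n)
      in complex_of_real
           (Gamma (m / 2) / (Gamma ((2 * lam + a) / a) * 2 * a powr (2 * lam / a) * pi powr (m / 2)))
         * (LINT x|lebesgue. deformed_integrand a f y x))"

text \<open>The weight exponent depends on \<open>p\<close> itself, not only on the quotient \<open>p / q\<close>.\<close>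

definition deformed_B :: "nat \<Rightarrow> nat \<Rightarrow> (real ^ 'n \<Rightarrow> complex) set" where
  "deformed_B p q =
     {f. integrable lebesgue f \<and>
         (\<integral>\<^sup>+ x. ennreal
            ((1 + norm x) powr (3 * real CARD('n) * real p / 2 - real CARD('n) + 2)
             * norm (f x) * norm x powr (real p / real q - 2)) \<partial>lebesgue) < \<infinity>}"

end

theory Submission
  imports Defs
begin

text \<open>
  Write \<open>m = 2 l + 2\<close> for the dimension, so that \<open>\<lambda> = l\<close> is a natural number, and
  \<open>N = 3 m p / 2 - m + 2\<close> for the weight exponent of the class. Everything follows by dominated
  convergence once the kernel \<open>K\<close> is known to be continuous in each variable and to satisfy
  \<open>|K(x, y)| \<le> C (1 + |x| |y|)^N\<close> (\<open>norm_deformed_kernel_le\<close>, \<open>continuous_on_deformed_kernel\<close>):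
  for \<open>|y| \<le> R\<close> the integrand is then dominated by \<open>C (1 + R)^N\<close> times the function whose integral
  the class requires to be finite.

  The kernel is a series in \<open>k\<close> of Bessel functions of order \<open>\<mu> = 2 (k + l) / a\<close> at
  \<open>w = (2 / a) z^(a / 2)\<close>, with \<open>z = |x| |y|\<close>, and its coefficients are \<open>O(k^(2 l))\<close>. The power
  series of \<open>J_\<mu>\<close> alone only yields bounds exponential in \<open>w\<close>; the heart of the proof is a bound that
  is polynomial in \<open>w\<close> and uniform in the order. For \<open>\<mu> = \<nu> + n\<close> with \<open>0 \<le> \<nu> \<le> 1\<close>, the recurrences for
  \<open>J\<close> and its derivative make the derivative of \<open>J_\<nu>^2 + 2 (J_(\<nu>+1)^2 + J_(\<nu>+2)^2 + ...)\<close> telescope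
  to \<open>(2 \<nu> / w) J_\<nu>^2\<close>, so that \<open>w^(-2 \<nu>)\<close> times this sum is decreasing. Comparing with its value
  at \<open>0\<close> gives \<open>|J_\<mu>(w)| \<le> (w / 2)^\<nu> / \<Gamma>(\<nu> + 1)\<close> (\<open>bessel_clifford_square_le\<close>), hence
  \<open>|J_\<mu>(w)| \<le> C (1 + w)\<close> for all real \<open>\<mu> \<ge> 0\<close>. Decay in the order is bought with powers of \<open>w\<close>: iterating
  \<open>2 \<mu> J_\<mu> = w (J_(\<mu>-1) + J_(\<mu>+1))\<close> gives \<open>\<mu>^L |J_\<mu>(w)| \<le> C w^L (1 + w)\<close> for \<open>\<mu> \<ge> L\<close>
  (\<open>bessel_J_order_decay\<close>).

  Taking \<open>L = m\<close>, the series of the kernel is dominated by \<open>\<Sum> 1 / (k + 1)^2\<close> and its sum grows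
  for \<open>z \<ge> 1\<close> at most like \<open>z^(a (m + 1) / 2 - l)\<close>, an exponent below \<open>N\<close> because \<open>a = p / q \<le> p\<close>.
  For \<open>z \<le> 1\<close> the factor \<open>z^(-l)\<close> is absorbed by writing \<open>z^(-l) J_\<mu>(w)\<close> as \<open>z^k\<close> times a continuous
  function of \<open>z\<close> (\<open>radial_part\<close>). At \<open>z = 0\<close> every term with \<open>k > 0\<close> then vanishes, while the
  term \<open>k = 0\<close> is normalised to \<open>1\<close>; this is the continuity of the kernel at \<open>x = 0\<close> or \<open>y = 0\<close>.
\<close>

section \<open>Bessel--Clifford functions\<close>

text \<open>
  The entire factor of the Bessel function: \<open>J_\<nu>(w) = (w / 2)^\<nu> C_\<nu>(- w^2 / 4)\<close>. Separating it from
  the power of \<open>w\<close> leaves a function that is smooth at \<open>0\<close> for every real \<open>\<nu>\<close>.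
\<close>

definition bessel_clifford :: "real \<Rightarrow> real \<Rightarrow> real" where
  "bessel_clifford \<nu> x = (\<Sum>j. rGamma (real j + \<nu> + 1) / fact j * x ^ j)"

lemma rGamma_real_pos:
  fixes x :: real assumes "x > 0" shows "rGamma x > 0"
  using Gamma_real_pos[OF assms] by (simp add: rGamma_inverse_Gamma)

lemma rGamma_shift_le:
  fixes \<nu> :: real
  assumes "\<nu> \<ge> 0"
  shows "rGamma (real n + \<nu> + 1) \<le> rGamma (\<nu> + 1) / fact n"
proof (induction n)
  case 0 then show ?case by simp
next
  case (Suc n)
  let ?x = "real n + \<nu> + 1"
  have "?x * rGamma (?x + 1) = rGamma ?x" by (rule rGamma_plus1)
  then have "rGamma (?x + 1) = rGamma ?x / ?x" using assms by (simp add: field_simps)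
  also have "\<dots> \<le> rGamma ?x / (real n + 1)"
    using assms rGamma_real_pos[of ?x] by (intro divide_left_mono) auto
  also have "\<dots> \<le> (rGamma (\<nu> + 1) / fact n) / (real n + 1)"
    using Suc by (intro divide_right_mono) auto
  finally show ?case by (simp add: field_simps)
qed

lemma bessel_clifford_term_le:
  assumes "\<nu> \<ge> 0"
  shows "\<bar>rGamma (real j + \<nu> + 1) / fact j * x ^ j\<bar> \<le> rGamma (\<nu> + 1) * (\<bar>x\<bar> ^ j /\<^sub>R fact j)"
proof -
  have p: "rGamma (real j + \<nu> + 1) > 0" using assms by (intro rGamma_real_pos) auto
  have "rGamma (real j + \<nu> + 1) \<le> rGamma (\<nu> + 1) / fact j" by (rule rGamma_shift_le[OF assms])
  also have "\<dots> \<le> rGamma (\<nu> + 1) / 1"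
    using rGamma_real_pos[of "\<nu>+1"] assms by (intro divide_left_mono) auto
  finally have "rGamma (real j + \<nu> + 1) \<le> rGamma (\<nu> + 1)" by simp
  then have "rGamma (real j + \<nu> + 1) * (\<bar>x\<bar> ^ j / fact j) \<le> rGamma (\<nu> + 1) * (\<bar>x\<bar> ^ j / fact j)"
    by (intro mult_right_mono) auto
  then show ?thesis using p by (simp add: abs_mult power_abs field_simps)
qed

lemma summable_bessel_clifford:
  assumes "\<nu> \<ge> 0"
  shows "summable (\<lambda>j. rGamma (real j + \<nu> + 1) / fact j * x ^ j)"
  by (rule summable_comparison_test'[where N = 0,
        OF summable_mult[OF summable_exp_generic[of "\<bar>x\<bar>"], of "rGamma (\<nu> + 1)"]])
     (use bessel_clifford_term_le[OF assms] in simp)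

lemma abs_bessel_clifford_le:
  assumes "\<nu> \<ge> 0"
  shows "\<bar>bessel_clifford \<nu> x\<bar> \<le> rGamma (\<nu> + 1) * exp \<bar>x\<bar>"
proof -
  have "norm (\<Sum>j. rGamma (real j + \<nu> + 1) / fact j * x ^ j)
      \<le> (\<Sum>j. rGamma (\<nu> + 1) * (\<bar>x\<bar> ^ j /\<^sub>R fact j))"
    using bessel_clifford_term_le[OF assms]
    by (intro norm_suminf_le summable_mult summable_exp_generic) auto
  also have "\<dots> = rGamma (\<nu> + 1) * exp \<bar>x\<bar>"
    by (subst suminf_mult[OF summable_exp_generic]) (simp add: exp_def)
  finally show ?thesis by (simp add: bessel_clifford_def)
qed

lemma bessel_clifford_0: "bessel_clifford \<nu> 0 = rGamma (\<nu> + 1)"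
  using powser_zero[of "\<lambda>j. rGamma (real j + \<nu> + 1) / fact j"]
  by (simp add: bessel_clifford_def)

lemma DERIV_bessel_clifford:
  assumes "\<nu> \<ge> 0"
  shows "(bessel_clifford \<nu> has_real_derivative bessel_clifford (\<nu> + 1) x) (at x)"
proof -
  let ?c = "\<lambda>j. rGamma (real j + \<nu> + 1) / fact j"
  have d: "diffs ?c = (\<lambda>j. rGamma (real j + (\<nu> + 1) + 1) / fact j)"
    by (rule ext) (simp add: diffs_def field_simps del: of_nat_Suc, simp add: algebra_simps)
  have "((\<lambda>x. \<Sum>j. ?c j * x ^ j) has_real_derivative (\<Sum>j. diffs ?c j * x ^ j)) (at x)"
    using summable_bessel_clifford[OF assms]
    by (intro termdiffs_strong'[where K = "\<bar>x\<bar> + 1"]) auto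
  then show ?thesis unfolding d by (simp add: bessel_clifford_def[abs_def])
qed

text \<open>
  The coefficientwise form of \<open>\<Gamma>(t + 1) = t \<Gamma>(t)\<close>: the coefficient of \<open>x^j\<close> on the left is
  \<open>j + \<nu> + 1\<close> times the one in \<open>C_(\<nu>+1)\<close>, and the summand \<open>j\<close> produces the shifted series \<open>x C_(\<nu>+2)\<close>.
\<close>

lemma bessel_clifford_recurrence:
  assumes "\<nu> \<ge> 0"
  shows "bessel_clifford \<nu> x = (\<nu> + 1) * bessel_clifford (\<nu> + 1) x + x * bessel_clifford (\<nu> + 2) x"
proof -
  let ?A = "\<lambda>\<nu> j. rGamma (real j + \<nu> + 1) / fact j * x ^ j"
  have s: "summable (?A \<nu>)" "summable (?A (\<nu> + 1))" "summable (?A (\<nu> + 2))"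
    using summable_bessel_clifford[of "\<nu>"] summable_bessel_clifford[of "\<nu> + 1"]
      summable_bessel_clifford[of "\<nu> + 2"] assms by simp_all
  have t: "?A \<nu> (Suc j) = (\<nu> + 1) * ?A (\<nu> + 1) (Suc j) + x * ?A (\<nu> + 2) j" for j
  proof -
    define r where "r = rGamma (real j + \<nu> + 3)"
    have "rGamma (real (Suc j) + \<nu> + 1) = (real j + \<nu> + 2) * r"
      using rGamma_plus1[of "real j + \<nu> + 2"] by (simp add: r_def add_ac)
    moreover have "rGamma (real (Suc j) + (\<nu> + 1) + 1) = r" "rGamma (real j + (\<nu> + 2) + 1) = r"
      by (simp_all add: r_def add_ac)
    ultimately show ?thesis
      by (simp only: fact_Suc power_Suc) (simp add: divide_simps, simp add: algebra_simps)
  qed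
  have s2: "summable (\<lambda>j. ?A (\<nu> + 1) (Suc j))"
    using s(2) by (subst summable_Suc_iff)
  have "(\<lambda>j. ?A \<nu> (Suc j)) sums
      ((\<nu> + 1) * (\<Sum>j. ?A (\<nu> + 1) (Suc j)) + x * (\<Sum>j. ?A (\<nu> + 2) j))"
    unfolding t by (intro sums_add sums_mult summable_sums s(3) s2)
  then have "(\<Sum>j. ?A \<nu> (Suc j)) = (\<nu> + 1) * (\<Sum>j. ?A (\<nu> + 1) (Suc j)) + x * (\<Sum>j. ?A (\<nu> + 2) j)"
    by (rule sums_unique[symmetric])
  moreover have "?A \<nu> 0 = (\<nu> + 1) * ?A (\<nu> + 1) 0"
    using rGamma_plus1[of "\<nu> + 1"] by (simp add: add_ac)
  moreover have "S0 = c * S1 + x * S2" if "S0 - A0 = c * (S1 - B0) + x * S2" "A0 = c * B0"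
    for S0 S1 S2 A0 B0 c :: real
    using that by (simp add: algebra_simps)
  ultimately show ?thesis
    unfolding bessel_clifford_def suminf_split_head[OF s(1)] suminf_split_head[OF s(2)] by blast
qed

lemma bessel_J_eq_bessel_clifford:
  assumes "\<nu> \<ge> 0" "w > 0"
  shows "bessel_J \<nu> w = (w / 2) powr \<nu> * bessel_clifford \<nu> (- ((w / 2)\<^sup>2))"
proof -
  have "(-1) ^ j / fact j * rGamma (real j + \<nu> + 1) * (w / 2) powr (2 * real j + \<nu>)
     = (w / 2) powr \<nu> * (rGamma (real j + \<nu> + 1) / fact j * (- ((w / 2)\<^sup>2)) ^ j)" for j
  proof -
    have "(w / 2) powr (2 * real j) = ((w/2)^2)^j"
      using powr_realpow[of "w / 2" "2 * j"] assms by (simp add: power_mult)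
    moreover have "(- ((w / 2)\<^sup>2)) ^ j = (-1) ^ j * ((w/2)^2)^j"
      by (rule power_minus)
    ultimately show ?thesis by (simp only: powr_add) (simp add: mult_ac)
  qed
  then show ?thesis
    unfolding bessel_J_def bessel_clifford_def
    by (simp only: suminf_mult[OF summable_bessel_clifford[OF assms(1)]])
qed

text \<open>
  In terms of Bessel functions, with \<open>u = w^2 / 4\<close>, this is \<open>|J_(\<nu>+n)(w)| \<le> (w / 2)^\<nu> / \<Gamma>(\<nu> + 1)\<close>.
  The order \<open>\<nu> + n\<close> may be arbitrarily large, yet the growth in \<open>w\<close> is governed by \<open>\<nu>\<close> alone. The
  partial sums \<open>T N\<close> of \<open>C_\<nu>^2 + 2 (u C_(\<nu>+1)^2 + u^2 C_(\<nu>+2)^2 + ...)\<close> at \<open>- u\<close> have a derivative that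
  telescopes to the single product \<open>- 2 Q N\<close> minus a nonnegative sum, and \<open>Q N\<close> tends to \<open>0\<close>
  factorially fast. Hence the full sum never exceeds its value at \<open>u = 0\<close>.
\<close>

lemma bessel_clifford_square_le:
  assumes "\<nu> \<ge> 0" "u \<ge> 0"
  shows "u ^ n * (bessel_clifford (\<nu> + real n) (-u))\<^sup>2 \<le> (rGamma (\<nu> + 1))\<^sup>2"
proof -
  define \<Lambda> where "\<Lambda> = (\<lambda>j t. bessel_clifford (\<nu> + real j) (-t))"
  define Q where "Q = (\<lambda>j t. t ^ j * \<Lambda> j t * \<Lambda> (Suc j) t)"
  define T where "T = (\<lambda>N t. (\<Lambda> 0 t)\<^sup>2 + 2 * (\<Sum>j<N. t ^ Suc j * (\<Lambda> (Suc j) t)\<^sup>2))"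
  have D\<Lambda>: "(\<Lambda> j has_real_derivative - \<Lambda> (Suc j) t) (at t)" for j t
  proof -
    have "((\<lambda>t. bessel_clifford (\<nu> + real j) (- t)) has_real_derivative
        bessel_clifford (\<nu> + real j + 1) (- t) * (- 1)) (at t)"
      by (rule DERIV_chain2[where g = uminus], rule DERIV_bessel_clifford)
        (use assms in \<open>auto intro!: derivative_eq_intros\<close>)
    then show ?thesis by (simp add: \<Lambda>_def add_ac)
  qed
  have rec: "(\<nu> + real j + 1) * \<Lambda> (Suc j) t = \<Lambda> j t + t * \<Lambda> (Suc (Suc j)) t" for j t
    unfolding \<Lambda>_def using bessel_clifford_recurrence[of "\<nu> + real j" "-t"] assms
    by (simp add: add_ac)
  have DT: "(T N has_real_derivative (- 2 * Q N t - 2 * \<nu> * (\<Sum>j<N. t ^ j * (\<Lambda> (Suc j) t)\<^sup>2))) (at t)" for N t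
  proof (induction N)
    case 0
    show ?case unfolding T_def Q_def by (auto intro!: derivative_eq_intros D\<Lambda>)
  next
    case (Suc N)
    \<comment> \<open>The left side is the derivative of the next summand. Rewriting one factor by the recurrence
      splits it into a telescoping difference and a term of known sign.\<close>
    have e: "(real N + 1) * t^N * (\<Lambda> (Suc N) t)\<^sup>2 - t ^ Suc N * (2 * \<Lambda> (Suc N) t * \<Lambda> (Suc (Suc N)) t)
        = Q N t - Q (Suc N) t - \<nu> * (t ^ N * (\<Lambda> (Suc N) t)\<^sup>2)"
    proof -
      have "(real N + 1) * \<Lambda> (Suc N) t = \<Lambda> N t + t * \<Lambda> (Suc (Suc N)) t - \<nu> * \<Lambda> (Suc N) t"
        using rec[of N t] by (simp add: algebra_simps)
      then have "(real N + 1) * \<Lambda> (Suc N) t * (t^N * \<Lambda> (Suc N) t)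
        = (\<Lambda> N t + t * \<Lambda> (Suc (Suc N)) t - \<nu> * \<Lambda> (Suc N) t) * (t^N * \<Lambda> (Suc N) t)"
        by simp
      then show ?thesis unfolding Q_def power2_eq_square by (simp add: algebra_simps)
    qed
    have "((\<lambda>t. T N t + 2 * (t ^ Suc N * (\<Lambda> (Suc N) t)\<^sup>2)) has_real_derivative
        (- 2 * Q N t - 2 * \<nu> * (\<Sum>j<N. t ^ j * (\<Lambda> (Suc j) t)\<^sup>2)) + 
        2 * ((real N + 1) * t^N * (\<Lambda> (Suc N) t)\<^sup>2 - t ^ Suc N * (2 * \<Lambda> (Suc N) t * \<Lambda> (Suc (Suc N)) t))) (at t)"
      by (rule derivative_eq_intros Suc D\<Lambda> refl)+ (simp add: algebra_simps)
    moreover have "(\<lambda>t. T N t + 2 * (t ^ Suc N * (\<Lambda> (Suc N) t)\<^sup>2)) = T (Suc N)"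
      by (simp add: T_def fun_eq_iff algebra_simps)
    moreover have "(- 2 * Q N t - 2 * \<nu> * (\<Sum>j<N. t ^ j * (\<Lambda> (Suc j) t)\<^sup>2))
        + 2 * (Q N t - Q (Suc N) t - \<nu> * (t ^ N * (\<Lambda> (Suc N) t)\<^sup>2))
        = - 2 * Q (Suc N) t - 2 * \<nu> * (\<Sum>j<Suc N. t ^ j * (\<Lambda> (Suc j) t)\<^sup>2)"
      by (simp add: algebra_simps)
    ultimately show ?case unfolding e by (simp only:)
  qed
  \<comment> \<open>A common bound for the two Bessel--Clifford factors in the error term, on all of [0, u].\<close>
  define C where "C = 2 * ((rGamma (\<nu> + 1))\<^sup>2 * (exp u)\<^sup>2)"
  have r0: "rGamma (\<nu> + 1) > 0" using assms by (intro rGamma_real_pos) auto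
  have \<Lambda>_le: "\<bar>\<Lambda> j t\<bar> \<le> rGamma (\<nu> + 1) / fact j * exp u" if "0 \<le> t" "t \<le> u" for j t
  proof -
    have "\<bar>\<Lambda> j t\<bar> \<le> rGamma (\<nu> + real j + 1) * exp \<bar>-t\<bar>"
      unfolding \<Lambda>_def by (rule abs_bessel_clifford_le) (use assms in auto)
    also have "\<dots> \<le> rGamma (\<nu> + 1) / fact j * exp u"
      using rGamma_shift_le[OF assms(1), of j] that r0
      by (intro mult_mono) (auto simp: add_ac)
    finally show ?thesis .
  qed
  have Q_le: "\<bar>2 * Q N t\<bar> \<le> C * (u ^ N / fact N)" if "0 \<le> t" "t \<le> u" for N t
  proof -
    have "\<bar>\<Lambda> (Suc N) t\<bar> \<le> rGamma (\<nu> + 1) * exp u"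
    proof -
      have "rGamma (\<nu> + 1) / fact (Suc N) \<le> rGamma (\<nu> + 1) / 1"
        using r0 by (intro divide_left_mono) (auto simp del: fact_Suc)
      then have "rGamma (\<nu> + 1) / fact (Suc N) * exp u \<le> rGamma (\<nu> + 1) / 1 * exp u"
        by (rule mult_right_mono) auto
      then show ?thesis using \<Lambda>_le[OF that, of "Suc N"] by simp
    qed
    moreover have "t ^ N \<le> u ^ N" using that by (intro power_mono)
    ultimately have "t ^ N * (\<bar>\<Lambda> N t\<bar> * \<bar>\<Lambda> (Suc N) t\<bar>) \<le> u ^ N * ((rGamma (\<nu> + 1) / fact N * exp u) * (rGamma (\<nu> + 1) * exp u))"
      using r0 that assms by (intro mult_mono \<Lambda>_le[OF that]) auto
    then show ?thesis using that
      by (simp add: Q_def C_def abs_mult power2_eq_square field_simps)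
  qed
  have TN: "T N u \<le> (rGamma (\<nu> + 1))\<^sup>2 + u * (C * (u ^ N / fact N))" for N
  proof (cases "u = 0")
    case True
    then show ?thesis by (simp add: T_def \<Lambda>_def bessel_clifford_0)
  next
    case False
    then have "u > 0" using assms by simp
    then obtain t where t: "0 < t" "t < u" 
      "T N u - T N 0 = (u - 0) * (- 2 * Q N t - 2 * \<nu> * (\<Sum>j<N. t ^ j * (\<Lambda> (Suc j) t)\<^sup>2))"
      using MVT2[of 0 u "T N", OF _ DT] by blast
    have "(\<Sum>j<N. t ^ j * (\<Lambda> (Suc j) t)\<^sup>2) \<ge> 0" using t by (intro sum_nonneg) auto
    then have "2 * \<nu> * (\<Sum>j<N. t ^ j * (\<Lambda> (Suc j) t)\<^sup>2) \<ge> 0" using assms by simp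
    then have "- 2 * Q N t - 2 * \<nu> * (\<Sum>j<N. t ^ j * (\<Lambda> (Suc j) t)\<^sup>2) \<le> C * (u ^ N / fact N)"
      using Q_le[of t N] t by linarith
    then have "T N u - T N 0 \<le> u * (C * (u ^ N / fact N))"
      unfolding t(3) diff_zero by (rule mult_left_mono) (fact assms)
    moreover have "T N 0 = (rGamma (\<nu> + 1))\<^sup>2" by (simp add: T_def \<Lambda>_def bessel_clifford_0)
    ultimately show ?thesis by simp
  qed
  have "(\<lambda>N. u ^ N / fact N) \<longlonglongrightarrow> 0"
    using summable_LIMSEQ_zero[OF summable_exp[of u]] by (simp add: field_simps)
  then have lim: "(\<lambda>N. (rGamma (\<nu> + 1))\<^sup>2 + u * (C * (u ^ N / fact N))) \<longlonglongrightarrow> (rGamma (\<nu> + 1))\<^sup>2 + u * (C * 0)"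
    by (intro tendsto_intros)
  have "u ^ n * (\<Lambda> n u)\<^sup>2 \<le> T N u" if "N \<ge> n" for N
  proof (cases n)
    case 0
    have "(\<Sum>j<N. u ^ Suc j * (\<Lambda> (Suc j) u)\<^sup>2) \<ge> 0" using assms by (intro sum_nonneg) auto
    then show ?thesis by (simp add: 0 T_def)
  next
    case (Suc i)
    have "u ^ Suc i * (\<Lambda> (Suc i) u)\<^sup>2 \<le> (\<Sum>j<N. u ^ Suc j * (\<Lambda> (Suc j) u)\<^sup>2)"
      using assms that Suc by (intro member_le_sum) auto
    moreover have "u ^ Suc i * (\<Lambda> (Suc i) u)\<^sup>2 \<ge> 0" "(\<Lambda> 0 u)\<^sup>2 \<ge> 0" using assms by auto
    ultimately show ?thesis unfolding T_def Suc by linarith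
  qed
  then have "\<forall>\<^sub>F N in sequentially. u ^ n * (\<Lambda> n u)\<^sup>2 \<le> (rGamma (\<nu> + 1))\<^sup>2 + u * (C * (u ^ N / fact N))"
    unfolding eventually_sequentially using TN order_trans by blast
  then have "u ^ n * (\<Lambda> n u)\<^sup>2 \<le> (rGamma (\<nu> + 1))\<^sup>2 + u * (C * 0)"
    by (rule tendsto_lowerbound[OF lim]) simp
  then show ?thesis by (simp add: \<Lambda>_def)
qed

section \<open>Polynomial bounds for Bessel functions, uniform in the order\<close>

lemma rGamma_bounded_unit_interval: "\<exists>C\<ge>0. \<forall>\<nu>\<in>{0..1}. rGamma (\<nu> + 1 :: real) \<le> C"
proof -
  have "continuous_on {0..1::real} (\<lambda>\<nu>. rGamma (\<nu> + 1))"
    by (intro continuous_on_compose2[OF continuous_on_rGamma[of UNIV]] continuous_intros) auto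
  then have "compact ((\<lambda>\<nu>. rGamma (\<nu> + 1)) ` {0..1::real})"
    by (rule compact_continuous_image) simp
  then have "bounded ((\<lambda>\<nu>. rGamma (\<nu> + 1)) ` {0..1::real})"
    by (rule compact_imp_bounded)
  then obtain C where C: "\<And>\<nu>. \<nu> \<in> {0..1::real} \<Longrightarrow> \<bar>rGamma (\<nu> + 1)\<bar> \<le> C"
    unfolding bounded_iff by fastforce
  have "C \<ge> 0" using C[of 0] abs_ge_zero by (rule order_trans[rotated]) simp
  moreover have "\<forall>\<nu>\<in>{0..1}. rGamma (\<nu> + 1 :: real) \<le> C"
    using C abs_ge_self order_trans by blast
  ultimately show ?thesis by blast
qed

lemma nonneg_real_floor_decomp:
  fixes \<mu> :: real
  assumes "\<mu> \<ge> 0"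
  obtains \<nu> n where "\<mu> = \<nu> + real n" "\<nu> \<in> {0..1}"
proof
  show "\<mu> = frac \<mu> + real (nat \<lfloor>\<mu>\<rfloor>)" using assms by (simp add: frac_def)
  show "frac \<mu> \<in> {0..1}" using frac_ge_0[of \<mu>] frac_lt_1[of \<mu>] by simp
qed

text \<open>
  The Gamma function beats every exponential. The fractional part of \<open>\<mu>\<close> ranges over a compact
  interval, so only the factorial coming from the integer part matters.
\<close>

lemma powr_mult_rGamma_bounded:
  fixes x :: real
  assumes "x \<ge> 0"
  shows "\<exists>C\<ge>0. \<forall>\<mu>\<ge>0. x powr \<mu> * rGamma (\<mu> + 1) \<le> C"
proof -
  obtain C where C: "C \<ge> 0" "\<And>\<nu>. \<nu> \<in> {0..1::real} \<Longrightarrow> rGamma (\<nu> + 1) \<le> C"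
    using rGamma_bounded_unit_interval by auto
  define X where "X = max 1 x"
  have X: "X \<ge> 1" "x \<le> X" by (auto simp: X_def)
  have "x powr \<mu> * rGamma (\<mu> + 1) \<le> X * exp X * C" if "\<mu> \<ge> 0" for \<mu>
  proof -
    obtain \<nu> n where n: "\<mu> = \<nu> + real n" "\<nu> \<in> {0..1}"
      using nonneg_real_floor_decomp[OF \<open>\<mu> \<ge> 0\<close>] .
    have "x powr \<mu> \<le> X powr \<mu>" using X assms that by (intro powr_mono2) auto
    also have "\<dots> \<le> X powr (real (Suc n))" using X n by (intro powr_mono) auto
    also have "\<dots> = X ^ Suc n" using X by (intro powr_realpow) auto
    finally have 1: "x powr \<mu> \<le> X * X ^ n" by simp
    have "rGamma (\<mu> + 1) \<le> rGamma (\<nu> + 1) / fact n"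
      using rGamma_shift_le[of \<nu> n] n by (simp add: add_ac)
    also have "\<dots> \<le> C / fact n" using C(2)[OF n(2)] by (intro divide_right_mono) auto
    finally have 2: "rGamma (\<mu> + 1) \<le> C / fact n" .
    have "X ^ n /\<^sub>R fact n \<le> exp X"
      using X sum_le_suminf[OF summable_exp_generic[of X], of "{n}"] by (simp add: exp_def)
    then have 3: "X ^ n / fact n \<le> exp X" by (simp add: field_simps)
    have "x powr \<mu> * rGamma (\<mu> + 1) \<le> (X * X ^ n) * (C / fact n)"
      using 1 2 X rGamma_real_pos[of "\<mu> + 1"] that by (intro mult_mono) auto
    also have "\<dots> = X * (X ^ n / fact n) * C" by simp
    also have "\<dots> \<le> X * exp X * C" using 3 X C by (intro mult_right_mono mult_left_mono) auto
    finally show ?thesis .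
  qed
  moreover have "X * exp X * C \<ge> 0" using X C by simp
  ultimately show ?thesis by blast
qed

lemma bessel_J_recurrence:
  assumes "\<nu> \<ge> 0" "w > 0"
  shows "2 * (\<nu> + 1) * bessel_J (\<nu> + 1) w = w * (bessel_J \<nu> w + bessel_J (\<nu> + 2) w)"
proof -
  define s where "s = w / 2"
  have s: "s > 0" "w = 2 * s" using assms by (auto simp: s_def)
  have p: "s powr (\<nu> + 1) = s powr \<nu> * s" "s powr (\<nu> + 2) = s powr \<nu> * s\<^sup>2"
    using s by (simp_all add: powr_add powr_numeral)
  have r: "bessel_clifford \<nu> (- s\<^sup>2)
      = (\<nu> + 1) * bessel_clifford (\<nu> + 1) (- s\<^sup>2) - s\<^sup>2 * bessel_clifford (\<nu> + 2) (- s\<^sup>2)"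
    using bessel_clifford_recurrence[OF assms(1), of "- s\<^sup>2"] by simp
  have J: "bessel_J (\<nu> + c) w = s powr (\<nu> + c) * bessel_clifford (\<nu> + c) (- s\<^sup>2)" if "c \<ge> 0" for c
    using bessel_J_eq_bessel_clifford[of "\<nu> + c" w] assms that by (simp add: s_def)
  show ?thesis
    using J[of 0] J[of 1] J[of 2] s(1) unfolding p by (simp add: r s(2) algebra_simps)
qed

text \<open>
  Splitting \<open>\<mu> = \<nu> + n\<close> into fractional and integer part, the bound of \<open>bessel_clifford_square_le\<close>
  reads \<open>(w / 2)^\<nu> / \<Gamma>(\<nu> + 1)\<close> with \<open>\<nu>\<close> in the unit interval.
\<close>

lemma bessel_J_linear_bound: "\<exists>C\<ge>0. \<forall>\<mu>\<ge>0. \<forall>w>0. \<bar>bessel_J \<mu> w\<bar> \<le> C * (1 + w)"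
proof -
  obtain C where C: "C \<ge> 0" "\<And>\<nu>. \<nu> \<in> {0..1::real} \<Longrightarrow> rGamma (\<nu> + 1) \<le> C"
    using rGamma_bounded_unit_interval by auto
  have "\<bar>bessel_J \<mu> w\<bar> \<le> C * (1 + w)" if "\<mu> \<ge> 0" "w > 0" for \<mu> w
  proof -
    obtain \<nu> n where n: "\<mu> = \<nu> + real n" "\<nu> \<in> {0..1}"
      using nonneg_real_floor_decomp[OF \<open>\<mu> \<ge> 0\<close>] .
    define s where "s = w / 2"
    have s: "s > 0" using that by (simp add: s_def)
    have r: "rGamma (\<nu> + 1) > 0" using n by (intro rGamma_real_pos) auto
    have "(bessel_J \<mu> w)\<^sup>2 = (s powr \<nu>)\<^sup>2 * ((s\<^sup>2) ^ n * (bessel_clifford (\<nu> + real n) (- s\<^sup>2))\<^sup>2)"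
      using bessel_J_eq_bessel_clifford[OF that] s
      by (simp add: s_def[symmetric] n(1) powr_add powr_realpow power_mult_distrib)
         (simp add: power_mult[symmetric] mult.commute)
    also have "\<dots> \<le> (s powr \<nu>)\<^sup>2 * (rGamma (\<nu> + 1))\<^sup>2"
      using bessel_clifford_square_le[of \<nu> "s\<^sup>2" n] n by (intro mult_left_mono) auto
    finally have "\<bar>bessel_J \<mu> w\<bar>\<^sup>2 \<le> (s powr \<nu> * rGamma (\<nu> + 1))\<^sup>2"
      by (simp add: power_mult_distrib)
    then have "\<bar>bessel_J \<mu> w\<bar> \<le> s powr \<nu> * rGamma (\<nu> + 1)"
      by (rule power2_le_imp_le) (use r in auto)
    also have "s powr \<nu> \<le> 1 + w"
    proof (cases "s \<le> 1")
      case True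
      then have "s powr \<nu> \<le> 1" using s n by (intro powr_le1) auto
      then show ?thesis using that by simp
    next
      case False
      then have "s powr \<nu> \<le> s powr 1" using n by (intro powr_mono) auto
      then show ?thesis using s by (simp add: s_def)
    qed
    then have "s powr \<nu> * rGamma (\<nu> + 1) \<le> (1 + w) * C"
      using C(2)[OF n(2)] r that by (intro mult_mono) auto
    finally show ?thesis by (simp add: mult.commute)
  qed
  then show ?thesis using C(1) by blast
qed

text \<open>
  Induction on \<open>L\<close>: \<open>2 \<mu> J_\<mu> = w (J_(\<mu>-1) + J_(\<mu>+1))\<close> gains one power of \<open>\<mu>\<close> for one power of \<open>w\<close>.
  The hypothesis \<open>\<mu> \<ge> L\<close> keeps the orders met on the way nonnegative and comparable with \<open>\<mu>\<close>.
\<close>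

lemma bessel_J_order_decay:
  "\<exists>C\<ge>0. \<forall>\<mu>\<ge>real L. \<forall>w>0. \<mu> ^ L * \<bar>bessel_J \<mu> w\<bar> \<le> C * w ^ L * (1 + w)"
proof (induction L)
  case 0
  then show ?case using bessel_J_linear_bound by simp
next
  case (Suc L)
  then obtain C where C: "C \<ge> 0"
    "\<And>\<mu> w. \<mu> \<ge> real L \<Longrightarrow> w > 0 \<Longrightarrow> \<mu> ^ L * \<bar>bessel_J \<mu> w\<bar> \<le> C * w ^ L * (1 + w)"
    by blast
  have "\<mu> ^ Suc L * \<bar>bessel_J \<mu> w\<bar> \<le> (2 ^ L * C) * w ^ Suc L * (1 + w)"
    if "\<mu> \<ge> real (Suc L)" "w > 0" for \<mu> w
  proof -
    define \<nu> where "\<nu> = \<mu> - 1"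
    have \<nu>: "\<nu> \<ge> real L" "\<mu> = \<nu> + 1" using that by (auto simp: \<nu>_def)
    \<comment> \<open>Both neighbouring orders satisfy the induction hypothesis with the bound B; passing from the
      power of the neighbouring order to that of \<open>\<mu>\<close> costs at most the factor 2 ^ L.\<close>
    define B where "B = C * w ^ L * (1 + w)"
    have B: "B \<ge> 0" using C that by (simp add: B_def)
    have "\<mu> ^ L \<le> 2 ^ L * \<nu> ^ L"
    proof (cases "L = 0")
      case False
      then have "\<nu> \<ge> 1" using \<nu> by linarith
      then have "\<mu> ^ L \<le> (2 * \<nu>) ^ L" using \<nu> by (intro power_mono) auto
      then show ?thesis by (simp add: power_mult_distrib)
    qed simp
    then have "\<mu> ^ L * \<bar>bessel_J \<nu> w\<bar> \<le> 2 ^ L * \<nu> ^ L * \<bar>bessel_J \<nu> w\<bar>"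
      by (intro mult_right_mono) auto
    also have "\<dots> \<le> 2 ^ L * B"
      using C(2)[of \<nu> w] \<nu> that by (simp add: B_def mult.assoc)
    finally have 1: "\<mu> ^ L * \<bar>bessel_J \<nu> w\<bar> \<le> 2 ^ L * B" .
    have "\<mu> ^ L * \<bar>bessel_J (\<nu> + 2) w\<bar> \<le> (\<nu> + 2) ^ L * \<bar>bessel_J (\<nu> + 2) w\<bar>"
      using \<nu> by (intro mult_right_mono power_mono) auto
    also have "\<dots> \<le> 1 * B" using C(2)[of "\<nu> + 2" w] \<nu> that by (simp add: B_def)
    also have "\<dots> \<le> 2 ^ L * B" using B by (intro mult_right_mono) auto
    finally have 2: "\<mu> ^ L * \<bar>bessel_J (\<nu> + 2) w\<bar> \<le> 2 ^ L * B" .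
    have \<mu>: "\<mu> \<ge> 0" "\<nu> \<ge> 0" using \<nu> by auto
    have "2 * \<mu> * \<bar>bessel_J \<mu> w\<bar> = \<bar>2 * (\<nu> + 1) * bessel_J (\<nu> + 1) w\<bar>"
      using \<mu> by (simp add: \<nu>(2) abs_mult)
    also have "\<dots> = w * \<bar>bessel_J \<nu> w + bessel_J (\<nu> + 2) w\<bar>"
      unfolding bessel_J_recurrence[OF \<open>\<nu> \<ge> 0\<close> \<open>w > 0\<close>] using that by (simp add: abs_mult)
    also have "\<dots> \<le> w * (\<bar>bessel_J \<nu> w\<bar> + \<bar>bessel_J (\<nu> + 2) w\<bar>)"
      using that by (intro mult_left_mono) auto
    finally have "\<mu> ^ L * (2 * \<mu> * \<bar>bessel_J \<mu> w\<bar>) \<le> \<mu> ^ L * (w * (\<bar>bessel_J \<nu> w\<bar> + \<bar>bessel_J (\<nu> + 2) w\<bar>))"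
      using \<mu> by (intro mult_left_mono) auto
    also have "\<dots> = w * (\<mu> ^ L * \<bar>bessel_J \<nu> w\<bar> + \<mu> ^ L * \<bar>bessel_J (\<nu> + 2) w\<bar>)"
      by (simp add: algebra_simps)
    also have "\<dots> \<le> w * (2 ^ L * B + 2 ^ L * B)"
      using 1 2 that by (intro mult_left_mono add_mono) auto
    finally show ?thesis by (simp add: B_def algebra_simps)
  qed
  moreover have "2 ^ L * C \<ge> 0" using C by simp
  ultimately show ?case by blast
qed

text \<open>
  The orders in the kernel form the progression \<open>c (k + l)\<close> with \<open>c = 2 / a\<close>. All but finitely many
  of them are at least \<open>L\<close>, where the decay in the order applies; on the others the weight
  \<open>(k + 1)^L\<close> is bounded.
\<close>

lemma bessel_J_progression_bound:
  fixes c l :: real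
  assumes "c > 0" "l \<ge> 0"
  shows "\<exists>C\<ge>0. \<forall>k. \<forall>w>0. real (Suc k) ^ L * \<bar>bessel_J (c * (real k + l)) w\<bar> \<le> C * (1 + w) ^ Suc L"
proof -
  obtain C0 where C0: "C0 \<ge> 0" "\<And>\<mu> w. \<mu> \<ge> 0 \<Longrightarrow> w > 0 \<Longrightarrow> \<bar>bessel_J \<mu> w\<bar> \<le> C0 * (1 + w)"
    using bessel_J_linear_bound by blast
  obtain C1 where C1: "C1 \<ge> 0"
    "\<And>\<mu> w. \<mu> \<ge> real L \<Longrightarrow> w > 0 \<Longrightarrow> \<mu> ^ L * \<bar>bessel_J \<mu> w\<bar> \<le> C1 * w ^ L * (1 + w)"
    using bessel_J_order_decay[of L] by blast
  define C where "C = (2 / c) ^ L * C1 + (real L / c + 1) ^ L * C0"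
  have C: "(2 / c) ^ L * C1 \<le> C" "(real L / c + 1) ^ L * C0 \<le> C" "C \<ge> 0"
    using C0(1) C1(1) assms by (auto simp: C_def)
  have "real (Suc k) ^ L * \<bar>bessel_J (c * (real k + l)) w\<bar> \<le> C * (1 + w) ^ Suc L" if "w > 0" for k w
  proof -
    define \<mu> where "\<mu> = c * (real k + l)"
    have \<mu>: "\<mu> \<ge> 0" "c * real k \<le> \<mu>" using assms by (auto simp: \<mu>_def)
    show ?thesis
    proof (cases "k \<ge> 1 \<and> \<mu> \<ge> real L")
      case True
      have "real (Suc k) \<le> 2 * real k" using True by simp
      also have "\<dots> \<le> 2 / c * \<mu>" using \<mu> assms by (simp add: field_simps)
      finally have "real (Suc k) ^ L \<le> (2 / c * \<mu>) ^ L" by (intro power_mono) auto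
      then have "real (Suc k) ^ L * \<bar>bessel_J \<mu> w\<bar> \<le> (2 / c * \<mu>) ^ L * \<bar>bessel_J \<mu> w\<bar>"
        by (intro mult_right_mono) auto
      also have "\<dots> = (2 / c) ^ L * (\<mu> ^ L * \<bar>bessel_J \<mu> w\<bar>)" by (simp only: power_mult_distrib mult.assoc)
      also have "\<dots> \<le> (2 / c) ^ L * (C1 * w ^ L * (1 + w))"
        using C1(2)[of \<mu> w] True that assms by (intro mult_left_mono) auto
      also have "\<dots> = ((2 / c) ^ L * C1) * (w ^ L * (1 + w))" by simp
      also have "\<dots> \<le> C * ((1 + w) ^ L * (1 + w))"
        using that C by (intro mult_mono power_mono) auto
      finally show ?thesis by (simp add: \<mu>_def mult.commute)
    next
      case False
      have "real (Suc k) \<le> real L / c + 1"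
      proof (cases "k = 0")
        case False
        then have "c * real k \<le> real L" using \<open>\<not> (k \<ge> 1 \<and> \<mu> \<ge> real L)\<close> \<mu> by linarith
        then show ?thesis using assms by (simp add: field_simps)
      qed (use assms in simp)
      then have "real (Suc k) ^ L * \<bar>bessel_J \<mu> w\<bar> \<le> (real L / c + 1) ^ L * (C0 * (1 + w))"
        using C0(2)[of \<mu> w] \<mu> that assms by (intro mult_mono power_mono) auto
      also have "\<dots> = ((real L / c + 1) ^ L * C0) * (1 + w)" by simp
      also have "\<dots> \<le> C * (1 + w) ^ Suc L"
      proof (intro mult_mono C)
        have "(1 + w) ^ 1 \<le> (1 + w) ^ Suc L" using that by (intro power_increasing) auto
        then show "1 + w \<le> (1 + w) ^ Suc L" by simp
      qed (use that in auto)
      finally show ?thesis by (simp add: \<mu>_def)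
    qed
  qed
  then show ?thesis using C(3) by blast
qed

section \<open>The radial part of the kernel\<close>

text \<open>
  This is \<open>z^(-l) J_\<nu>((2 / a) z^(a / 2))\<close> with \<open>\<nu> = 2 (k + l) / a\<close>, in a form that also makes sense at
  \<open>z = 0\<close>: the leading power \<open>z^(a \<nu> / 2) = z^(k + l)\<close> cancels \<open>z^(-l)\<close> and leaves \<open>z^k\<close>.
\<close>

definition radial_part :: "real \<Rightarrow> nat \<Rightarrow> nat \<Rightarrow> real \<Rightarrow> real" where
  "radial_part a l k z =
     (let \<nu> = 2 / a * (real k + real l)
      in a powr (- \<nu>) * z ^ k * bessel_clifford \<nu> (- (z powr a / a\<^sup>2)))"

lemma radial_part_eq_bessel_J:
  assumes "a > 0" "z > 0"
  shows "radial_part a l k z =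
    z powr (- real l) * bessel_J (2 / a * (real k + real l)) (2 / a * z powr (a / 2))"
proof -
  define \<nu> where "\<nu> = 2 / a * (real k + real l)"
  have \<nu>: "\<nu> \<ge> 0" using assms by (simp add: \<nu>_def)
  define s where "s = z powr (a / 2) / a"
  have s: "s > 0" using assms by (simp add: s_def)
  have "s powr \<nu> = z powr (a / 2 * \<nu>) * a powr (- \<nu>)"
    using assms by (simp add: s_def powr_divide powr_powr powr_minus_divide)
  also have "a / 2 * \<nu> = real k + real l" using assms by (simp add: \<nu>_def)
  also have "z powr (real k + real l) = z ^ k * z powr real l"
    using assms by (simp add: powr_add powr_realpow)
  finally have "s powr \<nu> = z ^ k * z powr real l * a powr (- \<nu>)" .
  moreover have "z powr (- real l) * z powr real l = 1"
    using assms by (simp add: powr_add[symmetric])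
  ultimately have 1: "z powr (- real l) * s powr \<nu> = a powr (- \<nu>) * z ^ k"
    by (simp add: algebra_simps)
  have 2: "s\<^sup>2 = z powr a / a\<^sup>2"
    using assms by (simp add: s_def power_divide power2_eq_square powr_add[symmetric])
  have "bessel_J \<nu> (2 * s) = s powr \<nu> * bessel_clifford \<nu> (- s\<^sup>2)"
    using bessel_J_eq_bessel_clifford[of \<nu> "2 * s"] \<nu> s by simp
  moreover have "2 * s = 2 / a * z powr (a / 2)" by (simp add: s_def)
  ultimately have "bessel_J \<nu> (2 / a * z powr (a / 2)) = s powr \<nu> * bessel_clifford \<nu> (- (z powr a / a\<^sup>2))"
    using 2 by simp
  then show ?thesis
    unfolding radial_part_def Let_def \<nu>_def[symmetric] 1[symmetric] by (simp only: mult.assoc)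
qed

lemma radial_part_0:
  "radial_part a l k 0 = (if k = 0 then a powr (- (2 / a * real l)) * rGamma (2 / a * real l + 1) else 0)"
  by (simp add: radial_part_def bessel_clifford_0 Let_def)

lemma continuous_on_radial_part:
  assumes "a > 0"
  shows "continuous_on {0..} (radial_part a l k)"
proof -
  let ?\<nu> = "2 / a * (real k + real l)"
  have "continuous_on UNIV (bessel_clifford ?\<nu>)"
    using assms by (intro DERIV_continuous_on) (auto intro!: DERIV_bessel_clifford)
  moreover have "continuous_on {0..} (\<lambda>z. - (z powr a / a\<^sup>2))"
  proof -
    have "continuous_on {0..} (\<lambda>z. z powr a)"
      using assms by (intro continuous_on_powr') auto
    then show ?thesis unfolding divide_inverse by (intro continuous_on_minus continuous_on_mult continuous_on_const)
  qed
  ultimately have "continuous_on {0..} (\<lambda>z. bessel_clifford ?\<nu> (- (z powr a / a\<^sup>2)))"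
    by (rule continuous_on_compose2) simp
  then show ?thesis unfolding radial_part_def Let_def by (intro continuous_intros)
qed

text \<open>
  Here the power series suffices. Since \<open>k \<le> a \<nu> / 2\<close>, the weight \<open>(k + 1)^M\<close> and the prefactor
  \<open>a^(-\<nu>)\<close> are together at most exponential in \<open>\<nu>\<close>, and \<open>1 / \<Gamma>(\<nu> + 1)\<close> absorbs any exponential.
\<close>

lemma radial_part_bounded_near_0:
  assumes "a > 0"
  shows "\<exists>C\<ge>0. \<forall>k. \<forall>z\<in>{0..1}. real (Suc k) ^ M * \<bar>radial_part a l k z\<bar> \<le> C"
proof -
  \<comment> \<open>exp (a / 2) powr \<open>\<nu>\<close> dominates exp k, hence the weight; 1 / a accounts for the prefactor.\<close>
  define x where "x = exp (a / 2) / a"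
  have x: "x > 0" using assms by (simp add: x_def)
  obtain C where C: "C \<ge> 0" "\<And>\<mu>. \<mu> \<ge> 0 \<Longrightarrow> x powr \<mu> * rGamma (\<mu> + 1) \<le> C"
    using powr_mult_rGamma_bounded[of x] x by force
  define C' where "C' = fact M * exp 1 * C * exp (1 / a\<^sup>2)"
  have "real (Suc k) ^ M * \<bar>radial_part a l k z\<bar> \<le> C'" if "z \<in> {0..1}" for k z
  proof -
    define \<nu> where "\<nu> = 2 / a * (real k + real l)"
    have \<nu>: "\<nu> \<ge> 0" "a / 2 * \<nu> \<ge> real k" using assms by (auto simp: \<nu>_def)
    have r: "rGamma (\<nu> + 1) > 0" using \<nu> by (intro rGamma_real_pos) auto
    have "real (Suc k) ^ M /\<^sub>R fact M \<le> exp (real (Suc k))"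
      using sum_le_suminf[OF summable_exp_generic[of "real (Suc k)"], of "{M}"]
      by (simp add: exp_def)
    then have "real (Suc k) ^ M \<le> fact M * exp (real (Suc k))" by (simp add: field_simps)
    also have "\<dots> \<le> fact M * (exp 1 * exp (a / 2 * \<nu>))"
      using \<nu> by (simp add: exp_add[symmetric])
    also have "exp (a / 2 * \<nu>) = exp (a / 2) powr \<nu>" by (simp add: powr_def mult.commute)
    finally have 1: "real (Suc k) ^ M \<le> fact M * (exp 1 * exp (a / 2) powr \<nu>)" .
    have "z powr a \<le> 1" using that assms by (intro powr_le1) auto
    then have "\<bar>bessel_clifford \<nu> (- (z powr a / a\<^sup>2))\<bar> \<le> rGamma (\<nu> + 1) * exp (1 / a\<^sup>2)"
      using r assms by (intro order_trans[OF abs_bessel_clifford_le[OF \<nu>(1)]] mult_left_mono)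
        (auto simp: divide_right_mono)
    moreover have "z ^ k \<le> 1" using that by (intro power_le_one) auto
    ultimately have "\<bar>radial_part a l k z\<bar> \<le> a powr (- \<nu>) * 1 * (rGamma (\<nu> + 1) * exp (1 / a\<^sup>2))"
      unfolding radial_part_def Let_def \<nu>_def[symmetric] abs_mult
      using that by (intro mult_mono) (auto simp: power_abs)
    then have "real (Suc k) ^ M * \<bar>radial_part a l k z\<bar>
       \<le> (fact M * (exp 1 * exp (a / 2) powr \<nu>)) * (a powr (- \<nu>) * 1 * (rGamma (\<nu> + 1) * exp (1 / a\<^sup>2)))"
      using 1 by (intro mult_mono) auto
    also have "\<dots> = fact M * exp 1 * (x powr \<nu> * rGamma (\<nu> + 1)) * exp (1 / a\<^sup>2)"
    proof -
      have "x powr \<nu> = exp (a / 2) powr \<nu> * a powr (- \<nu>)"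
        using assms by (simp add: x_def powr_divide powr_minus_divide)
      then show ?thesis by simp
    qed
    also have "\<dots> \<le> C'" unfolding C'_def using C(2)[OF \<nu>(1)]
      by (intro mult_right_mono mult_left_mono) auto
    finally show ?thesis .
  qed
  moreover have "C' \<ge> 0" using C by (simp add: C'_def)
  ultimately show ?thesis by blast
qed

text \<open>
  For \<open>z \<ge> 1\<close> the progression bound with \<open>L = 2 l + 2\<close> gives \<open>z^(-l) (1 + w)^(2 l + 3)\<close>, where
  \<open>w\<close> is of size \<open>z^(a / 2)\<close>; this is where the exponent in the hypothesis comes from.
  Of the weight \<open>(k + 1)^(2 l + 2)\<close>, the part \<open>(k + 1)^(2 l)\<close> compensates for the angular factors and
  the rest makes the series over \<open>k\<close> converge.
\<close>

lemma radial_part_growth: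
  assumes "a > 0" "N \<ge> 0" and N: "a * (real l + 3 / 2) - real l \<le> N"
  shows "\<exists>C\<ge>0. \<forall>k. \<forall>z\<ge>0. real (Suc k) ^ (2 * l + 2) * \<bar>radial_part a l k z\<bar> \<le> C * (1 + z) powr N"
proof -
  obtain C0 where C0: "C0 \<ge> 0"
    "\<And>k z. z \<in> {0..1} \<Longrightarrow> real (Suc k) ^ (2 * l + 2) * \<bar>radial_part a l k z\<bar> \<le> C0"
    using radial_part_bounded_near_0[OF assms(1)] by blast
  obtain C1 where C1: "C1 \<ge> 0" "\<And>k w. w > 0 \<Longrightarrow>
      real (Suc k) ^ (2 * l + 2) * \<bar>bessel_J (2 / a * (real k + real l)) w\<bar> \<le> C1 * (1 + w) ^ Suc (2 * l + 2)"
    using bessel_J_progression_bound[of "2 / a" "real l" "2 * l + 2"] assms by auto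
  define C where "C = C0 + C1 * (1 + 2 / a) ^ Suc (2 * l + 2)"
  have C: "C \<ge> 0" "C0 \<le> C" "C1 * (1 + 2 / a) ^ Suc (2 * l + 2) \<le> C"
    using C0(1) C1(1) assms by (auto simp: C_def)
  have "real (Suc k) ^ (2 * l + 2) * \<bar>radial_part a l k z\<bar> \<le> C * (1 + z) powr N" if z: "z \<ge> 0" for k z
  proof (cases "z \<le> 1")
    case True
    then have "real (Suc k) ^ (2 * l + 2) * \<bar>radial_part a l k z\<bar> \<le> C * 1"
      using C0(2)[of z k] C z by simp
    also have "\<dots> \<le> C * (1 + z) powr N"
      using C assms z by (intro mult_left_mono ge_one_powr_ge_zero) auto
    finally show ?thesis .
  next
    case False
    define w where "w = 2 / a * z powr (a / 2)"
    have w: "w > 0" using False assms by (simp add: w_def)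
    have "1 \<le> z powr (a / 2)" using False assms by (intro ge_one_powr_ge_zero) auto
    then have "1 + w \<le> (1 + 2 / a) * z powr (a / 2)" by (simp add: w_def algebra_simps)
    moreover have pw: "(z powr (a / 2)) ^ n = z powr (a / 2 * real n)" for n
      using powr_realpow[of "z powr (a / 2)" n] False by (simp add: powr_powr)
    ultimately have "(1 + w) ^ Suc (2 * l + 2) \<le> ((1 + 2 / a) * z powr (a / 2)) ^ Suc (2 * l + 2)"
      using w by (intro power_mono) auto
    also have "\<dots> = (1 + 2 / a) ^ Suc (2 * l + 2) * z powr (a / 2 * real (Suc (2 * l + 2)))"
      by (simp only: power_mult_distrib pw)
    finally have "C1 * (1 + w) ^ Suc (2 * l + 2)
        \<le> C1 * ((1 + 2 / a) ^ Suc (2 * l + 2) * z powr (a / 2 * real (Suc (2 * l + 2))))"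
      using C1(1) by (intro mult_left_mono)
    then have "real (Suc k) ^ (2 * l + 2) * \<bar>bessel_J (2 / a * (real k + real l)) w\<bar>
        \<le> C1 * ((1 + 2 / a) ^ Suc (2 * l + 2) * z powr (a / 2 * real (Suc (2 * l + 2))))"
      using C1(2)[OF w, of k] by linarith
    then have "z powr (- real l) * (real (Suc k) ^ (2 * l + 2) * \<bar>bessel_J (2 / a * (real k + real l)) w\<bar>)
       \<le> z powr (- real l) * (C1 * ((1 + 2 / a) ^ Suc (2 * l + 2) * z powr (a / 2 * real (Suc (2 * l + 2)))))"
      by (rule mult_left_mono) simp
    moreover have "radial_part a l k z = z powr (- real l) * bessel_J (2 / a * (real k + real l)) w"
      using radial_part_eq_bessel_J[of a z l k] False assms by (simp add: w_def)
    ultimately have "real (Suc k) ^ (2 * l + 2) * \<bar>radial_part a l k z\<bar>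
       \<le> C1 * (1 + 2 / a) ^ Suc (2 * l + 2) * (z powr (- real l) * z powr (a / 2 * real (Suc (2 * l + 2))))"
      by (simp add: abs_mult mult_ac)
    also have "z powr (- real l) * z powr (a / 2 * real (Suc (2 * l + 2)))
        = z powr (a * (real l + 3 / 2) - real l)"
      by (simp add: powr_add[symmetric] algebra_simps)
    also have "C1 * (1 + 2 / a) ^ Suc (2 * l + 2) * \<dots> \<le> C * (1 + z) powr N"
    proof (rule mult_mono)
      have "z powr (a * (real l + 3 / 2) - real l) \<le> z powr N" using N False by (intro powr_mono) auto
      also have "\<dots> \<le> (1 + z) powr N" using assms z by (intro powr_mono2) auto
      finally show "z powr (a * (real l + 3 / 2) - real l) \<le> (1 + z) powr N" .
    qed (use C in auto)
    finally show ?thesis .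
  qed
  then show ?thesis using C(1) by blast
qed

section \<open>Gegenbauer polynomials of integer index\<close>

text \<open>
  Extending the summand by zero allows sums for different \<open>k\<close> to run over the same index set.
\<close>

definition gegenbauer_term :: "nat \<Rightarrow> real \<Rightarrow> real \<Rightarrow> nat \<Rightarrow> real" where
  "gegenbauer_term k lam t j =
     (if 2 * j \<le> k then (-1) ^ j * pochhammer lam (k - j) / (fact j * fact (k - 2 * j))
        * (2 * t) ^ (k - 2 * j) else 0)"

lemma gegenbauer_eq_sum: "k \<le> N \<Longrightarrow> gegenbauer k lam t = (\<Sum>j\<le>N. gegenbauer_term k lam t j)"
  unfolding gegenbauer_def gegenbauer_term_def
  by (subst sum.mono_neutral_right[of "{..N}" "{..k div 2}"]) (auto intro!: sum.cong)

text \<open>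
  With the common Pochhammer symbol and factorials cancelled, this is
  \<open>lam = (lam + a + b) - a - b\<close> for \<open>a = j + 1\<close> and \<open>b = k - 2 j\<close>.
\<close>

lemma gegenbauer_term_recurrence:
  "gegenbauer_term (Suc (Suc k)) lam t (Suc j) =
     gegenbauer_term (Suc (Suc k)) (lam + 1) t (Suc j)
     - 2 * t * gegenbauer_term (Suc k) (lam + 1) t (Suc j) + gegenbauer_term k (lam + 1) t j"
proof -
  consider "2 * j > k" | "k = 2 * j" | "k > 2 * j" by linarith
  then show ?thesis
  proof cases
    case 1 then show ?thesis by (simp add: gegenbauer_term_def)
  next
    case 2
    have p: "pochhammer lam (Suc j) = lam * pochhammer (lam + 1) j"
        "pochhammer (lam + 1) (Suc j) = pochhammer (lam + 1) j * (lam + 1 + real j)"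
      by (rule pochhammer_rec, rule pochhammer_Suc)
    have n: "Suc (Suc k) - Suc j = Suc j" "Suc (Suc k) - 2 * Suc j = 0" "k - j = j" "k - 2 * j = 0"
      "(2 * Suc j \<le> Suc k) = False"
      using 2 by auto
    show ?thesis
      unfolding gegenbauer_term_def n p fact_Suc using 2
      by (simp add: divide_simps) (simp add: algebra_simps)
  next
    case 3
    define i where "i = k - 2 * j - 1"
    have k: "k = Suc (2 * j + i)" using 3 by (simp add: i_def)
    have p: "pochhammer lam (Suc (Suc (j + i))) = lam * pochhammer (lam + 1) (Suc (j + i))" 
        "pochhammer (lam + 1) (Suc (Suc (j + i))) = pochhammer (lam + 1) (Suc (j + i)) * (lam + 1 + real (Suc (j + i)))"
       by (rule pochhammer_rec, rule pochhammer_Suc)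
    have n: "Suc (Suc k) - Suc j = Suc (Suc (j + i))" "Suc (Suc k) - 2 * Suc j = Suc i"
      "Suc k - Suc j = Suc (j + i)" "Suc k - 2 * Suc j = i" "k - j = Suc (j + i)" "k - 2 * j = Suc i"
      using k by auto
    have c: "(2 * Suc j \<le> Suc (Suc k)) = True" "(2 * Suc j \<le> Suc k) = True" "(2 * j \<le> k) = True"
      using k by auto
    have alg: "(-s) * (lam * P) / (a * F * (b * G)) * (X * T) =
        (-s) * (P * (lam + a + b)) / (a * F * (b * G)) * (X * T)
        - X * ((-s) * P / (a * F * G) * T) + s * P / (F * (b * G)) * (X * T)"
      if "a > 0" "b > 0" "F > 0" "G > 0" for s P a b F G X T :: real
      using that by (simp add: field_simps)
    have "lam + 1 + real (Suc (j + i)) = lam + real (Suc j) + real (Suc i)" by simp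
    then show ?thesis
      using alg[of "real (Suc j)" "real (Suc i)" "fact j" "fact i" "(-1) ^ j"
          "pochhammer (lam + 1) (Suc (j + i))" "2 * t" "(2 * t) ^ i"]
      unfolding gegenbauer_term_def n p fact_Suc c if_True by (simp add: mult_ac)
  qed
qed

text \<open>
  Coefficient extraction from \<open>G^(lam + 1) (1 - 2 t s + s^2) = G^lam\<close>, where \<open>G\<close> is the
  generating function \<open>1 / (1 - 2 t s + s^2)\<close>.
\<close>

lemma gegenbauer_recurrence:
  "gegenbauer (Suc (Suc k)) lam t =
     gegenbauer (Suc (Suc k)) (lam + 1) t - 2 * t * gegenbauer (Suc k) (lam + 1) t
     + gegenbauer k (lam + 1) t"
proof -
  let ?g = gegenbauer_term
  have 0: "?g (Suc (Suc k)) lam t 0 = ?g (Suc (Suc k)) (lam + 1) t 0 - 2 * t * ?g (Suc k) (lam + 1) t 0"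
  proof -
    have "pochhammer lam (Suc (Suc k)) = lam * pochhammer (lam + 1) (Suc k)" by (rule pochhammer_rec)
    moreover have "pochhammer (lam + 1) (Suc (Suc k)) = pochhammer (lam + 1) (Suc k) * (lam + 1 + real (Suc k))"
      by (rule pochhammer_Suc)
    ultimately show ?thesis unfolding gegenbauer_term_def fact_Suc
      by (simp add: divide_simps) (simp add: algebra_simps)
  qed
  show ?thesis
    unfolding gegenbauer_eq_sum[of "Suc (Suc k)" "Suc (Suc k)", OF order_refl]
      gegenbauer_eq_sum[of "Suc k" "Suc (Suc k)", OF le_SucI[OF order_refl]]
      gegenbauer_eq_sum[of k "Suc k", OF le_SucI[OF order_refl]]
      sum.atMost_Suc_shift[of _ "Suc k"] 0 gegenbauer_term_recurrence[of k lam t]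
    by (simp only: sum.distrib sum_subtractf sum_distrib_left[symmetric]) (simp only: algebra_simps)
qed

lemma gegenbauer_0: "gegenbauer 0 lam t = 1" by (simp add: gegenbauer_def)
lemma gegenbauer_1: "gegenbauer (Suc 0) lam t = 2 * lam * t" by (simp add: gegenbauer_def)

text \<open>
  The recurrence factors over the complex numbers: \<open>E k = D (k + 1) - cis \<theta> D k\<close> satisfies
  \<open>E (k + 1) = cis (- \<theta>) E k + g (k + 2)\<close>. Both first-order recurrences have multipliers of modulus
  one, so each of them merely sums up its inhomogeneity.
\<close>

lemma cos_recurrence_bound:
  fixes D g :: "nat \<Rightarrow> real"
  assumes rec: "\<And>k. g (Suc (Suc k)) = D (Suc (Suc k)) - 2 * cos \<theta> * D (Suc k) + D k"
    and 0: "g 0 = D 0" and 1: "g (Suc 0) = D (Suc 0) - 2 * cos \<theta> * D 0"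
  shows "\<bar>D k\<bar> \<le> real (Suc k) * (\<Sum>i\<le>k. \<bar>g i\<bar>)"
proof -
  define E where "E = (\<lambda>k. of_real (D (Suc k)) - cis \<theta> * of_real (D k))"
  have c: "cis \<theta> + cis (-\<theta>) = of_real (2 * cos \<theta>)" by (simp add: complex_eq_iff)
  have cc: "cis (-\<theta>) * cis \<theta> = 1" by (simp add: cis_mult)
  have E0: "E 0 = of_real (g (Suc 0)) + cis (-\<theta>) * of_real (g 0)"
  proof -
    have "E 0 = of_real (g (Suc 0)) + (of_real (2 * cos \<theta>) - cis \<theta>) * of_real (D 0)"
      by (simp add: E_def 1 algebra_simps)
    then show ?thesis unfolding c[symmetric] by (simp add: 0)
  qed
  have ES: "E (Suc k) = of_real (g (Suc (Suc k))) + cis (-\<theta>) * E k" for k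
  proof -
    have "of_real (g (Suc (Suc k))) = of_real (D (Suc (Suc k))) 
        - (cis \<theta> + cis (-\<theta>)) * of_real (D (Suc k)) + cis (-\<theta>) * cis \<theta> * of_real (D k)"
      unfolding rec c cc by simp
    then show ?thesis unfolding E_def by (simp add: algebra_simps)
  qed
  have E: "norm (E k) \<le> (\<Sum>i\<le>Suc k. \<bar>g i\<bar>)" for k
  proof (induction k)
    case 0
    show ?case unfolding E0
      by (rule order_trans[OF norm_triangle_ineq]) (simp add: norm_mult)
  next
    case (Suc k)
    then show ?case unfolding ES
      by (intro order_trans[OF norm_triangle_ineq]) (simp add: norm_mult)
  qed
  show ?thesis
  proof (induction k)
    case 0 then show ?case using \<open>g 0 = D 0\<close> by simp
  next
    case (Suc k)
    have "complex_of_real (D (Suc k)) = E k + cis \<theta> * of_real (D k)" by (simp add: E_def)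
    then have "norm (complex_of_real (D (Suc k))) \<le> norm (E k) + norm (cis \<theta> * of_real (D k))"
      by (metis norm_triangle_ineq)
    then have "\<bar>D (Suc k)\<bar> \<le> norm (E k) + \<bar>D k\<bar>" by (simp add: norm_mult)
    also have "\<dots> \<le> (\<Sum>i\<le>Suc k. \<bar>g i\<bar>) + real (Suc k) * (\<Sum>i\<le>k. \<bar>g i\<bar>)"
      using E Suc by (intro add_mono)
    also have "\<dots> \<le> (\<Sum>i\<le>Suc k. \<bar>g i\<bar>) + real (Suc k) * (\<Sum>i\<le>Suc k. \<bar>g i\<bar>)"
      by (intro add_left_mono mult_left_mono) auto
    finally show ?case by (simp add: algebra_simps)
  qed
qed

text \<open>
  Raising the index by one means solving the recurrence above with the polynomials of lower index
  as right-hand side, which costs two powers of \<open>k + 1\<close>. The induction starts from index \<open>0\<close>, where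
  only the polynomial of degree \<open>0\<close> is nonzero; that is why the first step costs a single power.
\<close>

lemma gegenbauer_le_power:
  assumes "t \<in> {-1..1}"
  shows "\<bar>gegenbauer k (real (Suc l)) t\<bar> \<le> real (Suc k) ^ (2 * l + 1)"
proof -
  have t: "cos (arccos t) = t" using assms by (simp add: cos_arccos)
  have step: "\<bar>gegenbauer k (lam + 1) t\<bar> \<le> real (Suc k) * (\<Sum>i\<le>k. \<bar>gegenbauer i lam t\<bar>)" for k lam
    using gegenbauer_recurrence[of _ lam t]
    by (intro cos_recurrence_bound[where \<theta> = "arccos t"])
      (simp_all add: gegenbauer_0 gegenbauer_1 t algebra_simps)
  show ?thesis
  proof (induction l arbitrary: k)
    case 0
    have "gegenbauer i 0 t = (if i = 0 then 1 else 0)" for i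
      unfolding gegenbauer_def by (auto intro!: sum.neutral simp: pochhammer_0_left)
    then have "(\<Sum>i\<le>k. \<bar>gegenbauer i 0 t\<bar>) = (\<Sum>i\<le>k. if i = 0 then 1 else 0)"
      by (intro sum.cong) auto
    then show ?case using step[of k 0] by simp
  next
    case (Suc l)
    have "(\<Sum>i\<le>k. \<bar>gegenbauer i (real (Suc l)) t\<bar>) \<le> (\<Sum>i\<le>k. real (Suc k) ^ (2 * l + 1))"
      by (intro sum_mono order_trans[OF Suc] power_mono) auto
    then have "real (Suc k) * (\<Sum>i\<le>k. \<bar>gegenbauer i (real (Suc l)) t\<bar>)
        \<le> real (Suc k) * (real (Suc k) * real (Suc k) ^ (2 * l + 1))"
      by (intro mult_left_mono) auto
    moreover have "real (Suc (Suc l)) = real (Suc l) + 1" by simp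
    ultimately show ?case using order_trans[OF step[of k "real (Suc l)"]] by (simp add: mult_ac add_ac)
  qed
qed

section \<open>The deformed kernel\<close>

text \<open>
  The factor multiplying the radial part in the \<open>k\<close>-th term, with all constants absorbed, so that
  the case of dimension two and the general case become one and the same series.
\<close>

definition angular_part :: "real \<Rightarrow> nat \<Rightarrow> nat \<Rightarrow> real \<Rightarrow> complex" where
  "angular_part a l k t =
     (if l = 0 then
        if k = 0 then 1
        else 2 * exp (- (\<i> * complex_of_real (pi * real k / a))) * complex_of_real (cos (real k * arccos t))
      else
        complex_of_real (a powr (2 * real l / a) * Gamma ((2 * real l + a) / a))
        * exp (- (\<i> * complex_of_real (pi * real k / a)))
        * complex_of_real ((real l + real k) / real l * gegenbauer k (real l) t))"

lemma angular_part_0: "angular_part a l 0 t = angular_part a l 0 0"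
  by (simp add: angular_part_def gegenbauer_0)

text \<open>
  At \<open>z = 0\<close> only the term \<open>k = 0\<close> survives; the normalisation of the kernel makes it \<open>1\<close>.
\<close>

lemma angular_part_0_mult_radial_part_0:
  assumes "a > 0"
  shows "complex_of_real (radial_part a l 0 0) * angular_part a l 0 t = 1"
proof (cases "l = 0")
  case True
  then show ?thesis using assms by (simp add: radial_part_0 angular_part_def rGamma_inverse_Gamma)
next
  case False
  define \<nu> where "\<nu> = 2 * real l / a"
  have \<nu>: "\<nu> \<ge> 0" "(2 * real l + a) / a = \<nu> + 1" "2 / a * real l = \<nu>"
    using assms by (auto simp: \<nu>_def field_simps)
  have "Gamma (\<nu> + 1) > 0" using \<nu> by (intro Gamma_real_pos) auto
  then have 1: "rGamma (\<nu> + 1) * Gamma (\<nu> + 1) = 1" by (simp add: rGamma_inverse_Gamma)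
  have 2: "a powr (- \<nu>) * a powr \<nu> = 1" using assms by (simp add: powr_add[symmetric])
  have "radial_part a l 0 0 * (a powr \<nu> * Gamma (\<nu> + 1)) = 
     (a powr (- \<nu>) * a powr \<nu>) * (rGamma (\<nu> + 1) * Gamma (\<nu> + 1))"
    unfolding radial_part_0 \<nu>(3) by simp
  then have "radial_part a l 0 0 * (a powr \<nu> * Gamma (\<nu> + 1)) = 1" unfolding 1 2 by simp
  then have "complex_of_real (radial_part a l 0 0) * of_real (a powr \<nu> * Gamma (\<nu> + 1)) = 1"
    by (metis of_real_mult of_real_1)
  then show ?thesis
    using False by (simp add: angular_part_def gegenbauer_0 \<nu>(2) \<nu>_def[symmetric])
qed

lemma angular_part_bound:
  "\<exists>B\<ge>0. \<forall>k. \<forall>t\<in>{-1..1}. norm (angular_part a l k t) \<le> B * real (Suc k) ^ (2 * l)"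
proof -
  define c where "c = a powr (2 * real l / a) * Gamma ((2 * real l + a) / a)"
  have e: "norm (exp (- (\<i> * complex_of_real r))) = 1" for r by (simp add: norm_exp_eq_Re)
  \<comment> \<open>The summand 2 serves the cosine series, the summand \<open>\<bar>c\<bar>\<close> the Gegenbauer series.\<close>
  have "norm (angular_part a l k t) \<le> (2 + \<bar>c\<bar>) * real (Suc k) ^ (2 * l)" if t: "t \<in> {-1..1}" for k t
  proof (cases "l = 0")
    case True
    have "\<bar>cos (real k * arccos t)\<bar> \<le> 1" by (rule abs_cos_le_one)
    moreover have "norm (angular_part a l k t) \<le> 2 * max 1 \<bar>cos (real k * arccos t)\<bar>"
      using True by (simp add: angular_part_def norm_mult e)
    ultimately show ?thesis using True by simp
  next
    case False
    then obtain n where n: "l = Suc n" by (cases l) auto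
    have "norm (angular_part a l k t) = \<bar>c\<bar> * ((real l + real k) / real l * \<bar>gegenbauer k (real l) t\<bar>)"
    proof -
      have "angular_part a l k t = complex_of_real c * exp (- (\<i> * complex_of_real (pi * real k / a)))
          * complex_of_real ((real l + real k) / real l * gegenbauer k (real l) t)"
        using False by (simp only: angular_part_def c_def if_False)
      then show ?thesis by (simp only: norm_mult e norm_of_real abs_mult) simp
    qed
    also have "\<dots> \<le> \<bar>c\<bar> * (real (Suc k) * real (Suc k) ^ (2 * n + 1))"
    proof (intro mult_left_mono mult_mono)
      have "1 * real k \<le> real l * real k" using False by (intro mult_right_mono) auto
      then show "(real l + real k) / real l \<le> real (Suc k)" using False by (simp add: field_simps)
      show "\<bar>gegenbauer k (real l) t\<bar> \<le> real (Suc k) ^ (2 * n + 1)"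
        unfolding n by (rule gegenbauer_le_power[OF t])
    qed auto
    also have "\<dots> = \<bar>c\<bar> * real (Suc k) ^ (2 * l)" by (simp add: n)
    also have "\<dots> \<le> (2 + \<bar>c\<bar>) * real (Suc k) ^ (2 * l)" by (intro mult_right_mono) auto
    finally show ?thesis .
  qed
  moreover have "2 + \<bar>c\<bar> \<ge> 0" by simp
  ultimately show ?thesis by blast
qed

lemma continuous_on_angular_part: "continuous_on {-1..1} (angular_part a l k)"
proof -
  have g: "continuous_on {-1..1} (gegenbauer k (real l))"
    unfolding gegenbauer_def[abs_def] by (intro continuous_intros)
  have c: "continuous_on {-1..1} (\<lambda>t. cos (real k * arccos t))"
    by (intro continuous_on_cos continuous_on_mult continuous_on_const continuous_on_arccos') 
  show ?thesis
  proof (cases "l = 0")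
    case True
    then show ?thesis
      by (cases "k = 0") (simp_all add: angular_part_def[abs_def]
          continuous_on_mult continuous_on_of_real c)
  next
    case False
    then have "angular_part a l k = (\<lambda>t.
        complex_of_real (a powr (2 * real l / a) * Gamma ((2 * real l + a) / a))
        * exp (- (\<i> * complex_of_real (pi * real k / a)))
        * complex_of_real ((real l + real k) / real l * gegenbauer k (real l) t))"
      by (simp add: angular_part_def fun_eq_iff)
    then show ?thesis
      by (simp only:) (intro continuous_on_mult continuous_on_const continuous_on_of_real g)
  qed
qed

lemma deformed_kernel_term_bound:
  assumes "a > 0" "N \<ge> 0" "a * (real l + 3 / 2) - real l \<le> N"
  shows "\<exists>C\<ge>0. \<forall>k. \<forall>z\<ge>0. \<forall>t\<in>{-1..1}.
    norm (complex_of_real (radial_part a l k z) * angular_part a l k t)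
      \<le> C * (1 + z) powr N * inverse (real (Suc k) ^ 2)"
proof -
  obtain C where C: "C \<ge> 0"
    "\<And>k z. z \<ge> 0 \<Longrightarrow> real (Suc k) ^ (2 * l + 2) * \<bar>radial_part a l k z\<bar> \<le> C * (1 + z) powr N"
    using radial_part_growth[OF assms] by blast
  obtain B where B: "B \<ge> 0"
    "\<And>k t. t \<in> {-1..1} \<Longrightarrow> norm (angular_part a l k t) \<le> B * real (Suc k) ^ (2 * l)"
    using angular_part_bound[of a l] by blast
  have "norm (complex_of_real (radial_part a l k z) * angular_part a l k t)
      \<le> (B * C) * (1 + z) powr N * inverse (real (Suc k) ^ 2)" if "z \<ge> 0" "t \<in> {-1..1}" for k z t
  proof -
    have "norm (complex_of_real (radial_part a l k z) * angular_part a l k t)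
       \<le> \<bar>radial_part a l k z\<bar> * (B * real (Suc k) ^ (2 * l))"
      unfolding norm_mult norm_of_real by (intro mult_left_mono B that) auto
    also have "\<dots> = B * (real (Suc k) ^ (2 * l + 2) * \<bar>radial_part a l k z\<bar>) * inverse (real (Suc k) ^ 2)"
    proof -
      define m where "m = real (Suc k) ^ 2"
      have "m * inverse m = 1" by (simp add: m_def del: of_nat_Suc)
      moreover have "B * (real (Suc k) ^ (2 * l + 2) * \<bar>radial_part a l k z\<bar>) * inverse m
         = (m * inverse m) * (\<bar>radial_part a l k z\<bar> * (B * real (Suc k) ^ (2 * l)))"
        by (simp only: power_add m_def mult_ac)
      ultimately show ?thesis by (simp only: m_def mult_1_left)
    qed
    also have "\<dots> \<le> B * (C * (1 + z) powr N) * inverse (real (Suc k) ^ 2)"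
      by (intro mult_right_mono mult_left_mono C B that) auto
    finally show ?thesis by (simp only: mult.assoc)
  qed
  moreover have "B * C \<ge> 0" using B(1) C(1) by simp
  ultimately show ?thesis by blast
qed

lemma summable_inverse_Suc_squares: "summable (\<lambda>k. inverse (real (Suc k) ^ 2))"
  using inverse_power_summable[of 2, where 'a = real] by (subst summable_Suc_iff) simp

lemma summable_deformed_kernel_term:
  assumes "a > 0" "z \<ge> 0" "t \<in> {-1..1}"
  shows "summable (\<lambda>k. complex_of_real (radial_part a l k z) * angular_part a l k t)"
proof -
  define N where "N = max 0 (a * (real l + 3 / 2) - real l)"
  have "N \<ge> 0" "a * (real l + 3 / 2) - real l \<le> N" by (auto simp: N_def)
  from deformed_kernel_term_bound[OF assms(1) this] obtain C
    where "\<And>k. norm (complex_of_real (radial_part a l k z) * angular_part a l k t)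
      \<le> C * (1 + z) powr N * inverse (real (Suc k) ^ 2)"
    using assms(2,3) by blast
  then show ?thesis
    by (intro summable_comparison_test'[OF summable_mult[OF summable_inverse_Suc_squares], of 0])
qed

lemma inner_divide_norms_in_interval:
  fixes x y :: "'a::real_inner"
  shows "inner x y / (norm x * norm y) \<in> {-1..1}"
proof -
  have "\<bar>inner x y / (norm x * norm y)\<bar> \<le> 1"
    using Cauchy_Schwarz_ineq2[of x y] by (cases "x = 0 \<or> y = 0") (auto simp: abs_mult divide_le_eq)
  then show ?thesis by (simp only: abs_le_iff atLeastAtMost_iff minus_le_iff)
qed

text \<open>
  One series represents the kernel for all arguments, including those where it is defined by its
  limit value.
\<close>

lemma deformed_kernel_eq_series:
  fixes x y :: "real ^ 'n"
  assumes "a > 0" and l: "CARD('n) = 2 * l + 2"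
  shows "deformed_kernel a x y = (\<Sum>k. complex_of_real (radial_part a l k (norm x * norm y))
      * angular_part a l k (inner x y / (norm x * norm y)))"
proof -
  define z where "z = norm x * norm y"
  define t where "t = inner x y / z"
  define F where "F = (\<lambda>k. complex_of_real (radial_part a l k z) * angular_part a l k t)"
  have t: "t \<in> {-1..1}" unfolding t_def z_def by (rule inner_divide_norms_in_interval)
  have "z \<ge> 0" by (simp add: z_def)
  then have F: "summable F" unfolding F_def by (rule summable_deformed_kernel_term[OF assms(1) _ t])
  have lam: "gegenbauer_index TYPE('n) = real l" using l by (simp add: gegenbauer_index_def)
  have "deformed_kernel a x y = suminf F"
  proof (cases "x = 0 \<or> y = 0")
    case True
    then have "z = 0" by (auto simp: z_def)
    have "F sums F 0"
      using sums_finite[of "{0}" F] by (simp add: F_def \<open>z = 0\<close> radial_part_0)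
    moreover have "F 0 = 1"
      unfolding F_def \<open>z = 0\<close> by (rule angular_part_0_mult_radial_part_0[OF assms(1)])
    ultimately show ?thesis using True by (simp add: sums_iff deformed_kernel_def Let_def)
  next
    case False
    then have z: "z > 0" by (simp add: z_def)
    define w where "w = 2 / a * z powr (a / 2)"
    have R: "radial_part a l k z = z powr (- real l) * bessel_J (2 * (real k + real l) / a) w" for k
      using radial_part_eq_bessel_J[OF assms(1) z] by (simp add: w_def)
    show ?thesis
    proof (cases "l = 0")
      case True
      define g where "g = (\<lambda>k. exp (- (\<i> * complex_of_real (pi * real (Suc k) / a)))
          * complex_of_real (bessel_J (2 * real (Suc k) / a) w * cos (real (Suc k) * arccos t)))"
      have R0: "radial_part a 0 k z = bessel_J (2 * real k / a) w" for k
        using R[of k] True z by simp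
      have "F (Suc k) = 2 * g k" for k
        unfolding F_def g_def True R0 angular_part_def by simp
      moreover have "F 0 = complex_of_real (bessel_J 0 w)"
        by (simp add: F_def R0 True angular_part_def)
      moreover have "summable (\<lambda>k. F (Suc k))" using F by (subst summable_Suc_iff)
      ultimately have "suminf F = complex_of_real (bessel_J 0 w) + 2 * suminf g"
        using suminf_split_head[OF F] by (simp add: summable_cmult_iff suminf_mult)
      then show ?thesis
        using False l True by (simp add: deformed_kernel_def Let_def g_def w_def t_def z_def)
    next
      case l0: False
      define c where "c = complex_of_real (a powr (2 * real l / a) * Gamma ((2 * real l + a) / a))"
      define g where "g = (\<lambda>k. exp (- (\<i> * complex_of_real (pi * real k / a)))
          * complex_of_real ((real l + real k) / real l * z powr (- real l)
                    * bessel_J (2 * (real k + real l) / a) w * gegenbauer k (real l) t))"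
      have "Gamma ((2 * real l + a) / a) > 0"
        using assms by (intro Gamma_real_pos) (auto intro!: divide_pos_pos)
      then have "a powr (2 * real l / a) * Gamma ((2 * real l + a) / a) > 0"
        using assms by (intro mult_pos_pos) auto
      then have c: "c \<noteq> 0" unfolding c_def of_real_eq_0_iff by (rule less_imp_neq[symmetric])
      have "angular_part a l k t = c * exp (- (\<i> * complex_of_real (pi * real k / a)))
          * complex_of_real ((real l + real k) / real l * gegenbauer k (real l) t)" for k
        using l0 by (simp only: angular_part_def c_def if_False)
      then have Fg: "F = (\<lambda>k. c * g k)"
        by (simp only: F_def g_def R of_real_mult mult_ac)
      have "summable g" using F c unfolding Fg by (simp add: summable_cmult_iff)
      then have "suminf F = c * suminf g" unfolding Fg by (rule suminf_mult)
      moreover have "deformed_kernel a x y = c * suminf g"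
        using False l l0 unfolding deformed_kernel_def Let_def lam
        by (simp only: if_False c_def g_def w_def t_def z_def) simp
      ultimately show ?thesis by simp
    qed
  qed
  then show ?thesis by (simp only: F_def t_def z_def)
qed

lemma norm_deformed_kernel_le:
  assumes "a > 0" "N \<ge> 0" "a * (real l + 3 / 2) - real l \<le> N" and l: "CARD('n) = 2 * l + 2"
  shows "\<exists>C\<ge>0. \<forall>x y :: real ^ 'n. norm (deformed_kernel a x y) \<le> C * (1 + norm x * norm y) powr N"
proof -
  obtain C where C: "C \<ge> 0" "\<And>k z t. z \<ge> 0 \<Longrightarrow> t \<in> {-1..1} \<Longrightarrow>
     norm (complex_of_real (radial_part a l k z) * angular_part a l k t)
      \<le> C * (1 + z) powr N * inverse (real (Suc k) ^ 2)"
    using deformed_kernel_term_bound[OF assms(1-3)] by blast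
  define S where "S = (\<Sum>k. inverse (real (Suc k) ^ 2))"
  have S: "S \<ge> 0" unfolding S_def by (intro suminf_nonneg summable_inverse_Suc_squares) auto
  have "norm (deformed_kernel a x y) \<le> (C * S) * (1 + norm x * norm y) powr N" for x y :: "real ^ 'n"
  proof -
    have "norm (deformed_kernel a x y) \<le> (\<Sum>k. C * (1 + norm x * norm y) powr N * inverse (real (Suc k) ^ 2))"
      unfolding deformed_kernel_eq_series[OF assms(1) l]
      by (intro norm_suminf_le C summable_mult summable_inverse_Suc_squares inner_divide_norms_in_interval) auto
    also have "\<dots> = C * (1 + norm x * norm y) powr N * S"
      unfolding S_def by (rule suminf_mult[OF summable_inverse_Suc_squares])
    finally show ?thesis by (simp add: mult_ac)
  qed
  moreover have "C * S \<ge> 0" using C(1) S by simp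
  ultimately show ?thesis by blast
qed

text \<open>
  The cosine of the angle between \<open>x\<close> and \<open>y\<close> has no limit as \<open>y\<close> tends to \<open>0\<close>. For \<open>k > 0\<close> this is
  harmless, as the angular part is bounded and the radial part tends to \<open>0\<close>; for \<open>k = 0\<close> the angular
  part is constant.
\<close>

lemma continuous_on_deformed_kernel_term:
  fixes x :: "'a::real_inner"
  assumes "a > 0" "x \<noteq> 0"
  shows "continuous_on UNIV (\<lambda>y. complex_of_real (radial_part a l k (norm x * norm y))
      * angular_part a l k (inner x y / (norm x * norm y)))" (is "continuous_on UNIV ?T")
proof -
  have r: "continuous_on UNIV (\<lambda>y. complex_of_real (radial_part a l k (norm x * norm y)))"
    by (intro continuous_on_of_real continuous_on_compose2[OF continuous_on_radial_part[OF assms(1)]]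
        continuous_intros) auto
  show ?thesis
  proof (cases "k = 0")
    case True
    then have "?T = (\<lambda>y. complex_of_real (radial_part a l k (norm x * norm y)) * angular_part a l 0 0)"
      using angular_part_0[of a l] by (simp add: fun_eq_iff)
    then show ?thesis by (simp only:) (intro continuous_on_mult r continuous_on_const)
  next
    case False
    have "isCont ?T y" for y
    proof (cases "y = 0")
      case True
      obtain B where B: "B \<ge> 0" "\<And>k t. t \<in> {-1..1} \<Longrightarrow> norm (angular_part a l k t) \<le> B * real (Suc k) ^ (2 * l)"
        using angular_part_bound[of a l] by blast
      have "isCont (\<lambda>y. complex_of_real (radial_part a l k (norm x * norm y))) 0"
        using r unfolding continuous_on_eq_continuous_at[OF open_UNIV] by blast
      then have "((\<lambda>y. complex_of_real (radial_part a l k (norm x * norm y))) \<longlongrightarrow> 0) (at 0)"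
        unfolding isCont_def using False by (simp add: radial_part_0)
      then have "((\<lambda>y. norm (complex_of_real (radial_part a l k (norm x * norm y))) * (B * real (Suc k) ^ (2 * l))) \<longlongrightarrow> norm (0::complex) * (B * real (Suc k) ^ (2 * l))) (at 0)"
        by (intro tendsto_intros)
      then have lim: "((\<lambda>y. norm (complex_of_real (radial_part a l k (norm x * norm y))) * (B * real (Suc k) ^ (2 * l))) \<longlongrightarrow> 0) (at 0)"
        by (simp only: norm_zero mult_zero_left)
      have "norm (?T y) \<le> norm (complex_of_real (radial_part a l k (norm x * norm y))) * (B * real (Suc k) ^ (2 * l))" for y
        unfolding norm_mult by (rule mult_left_mono[OF B(2)[OF inner_divide_norms_in_interval] norm_ge_zero])
      then have "(?T \<longlongrightarrow> 0) (at 0)"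
        by (intro Lim_null_comparison[OF _ lim] always_eventually allI)
      then show ?thesis unfolding isCont_def using False True by (simp add: radial_part_0)
    next
      case False
      have "continuous_on (- {0}) (\<lambda>y. inner x y / (norm x * norm y))"
        using assms by (intro continuous_intros) auto
      then have "continuous_on (- {0}) (\<lambda>y. angular_part a l k (inner x y / (norm x * norm y)))"
        by (rule continuous_on_compose2[OF continuous_on_angular_part]) (use inner_divide_norms_in_interval in blast)
      then have "continuous_on (- {0}) ?T"
        by (intro continuous_on_mult continuous_on_subset[OF r]) auto
      then show ?thesis using False by (simp add: continuous_on_eq_continuous_at open_Compl)
    qed
    then show ?thesis by (simp add: continuous_on_eq_continuous_at)
  qed
qed

text \<open>
  The terms are bounded by a constant times \<open>1 / (k + 1)^2\<close> uniformly for \<open>y\<close> in a ball, so the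
  Weierstrass test applies on every ball.
\<close>

lemma continuous_on_deformed_kernel:
  fixes x :: "real ^ 'n"
  assumes "a > 0" and l: "CARD('n) = 2 * l + 2"
  shows "continuous_on UNIV (deformed_kernel a x)"
proof (cases "x = 0")
  case True
  then show ?thesis by (simp add: deformed_kernel_def[abs_def] Let_def)
next
  case False
  define N where "N = max 0 (a * (real l + 3 / 2) - real l)"
  define T where "T = (\<lambda>k y. complex_of_real (radial_part a l k (norm x * norm y))
      * angular_part a l k (inner x y / (norm x * norm y)))"
  have "N \<ge> 0" "a * (real l + 3 / 2) - real l \<le> N" by (auto simp: N_def)
  from deformed_kernel_term_bound[OF assms(1) this]
  obtain C where C: "C \<ge> 0" "\<And>k z t. z \<ge> 0 \<Longrightarrow> t \<in> {-1..1} \<Longrightarrow>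
     norm (complex_of_real (radial_part a l k z) * angular_part a l k t)
      \<le> C * (1 + z) powr N * inverse (real (Suc k) ^ 2)"
    by blast
  have cb: "continuous_on (ball 0 R) (deformed_kernel a x)" for R
  proof -
    have "uniform_limit (ball 0 R) (\<lambda>n y. \<Sum>k<n. T k y) (\<lambda>y. \<Sum>k. T k y) sequentially"
    proof (rule Weierstrass_m_test)
      fix k and y :: "real ^ 'n" assume "y \<in> ball 0 R"
      then have "norm x * norm y \<le> norm x * R" by (intro mult_left_mono) auto
      then have "(1 + norm x * norm y) powr N \<le> (1 + norm x * R) powr N"
        by (intro powr_mono2) (auto simp: N_def)
      then have "C * (1 + norm x * norm y) powr N * inverse (real (Suc k) ^ 2)
         \<le> C * (1 + norm x * R) powr N * inverse (real (Suc k) ^ 2)"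
        using C(1) by (intro mult_right_mono mult_left_mono) auto
      moreover have "norm (T k y) \<le> C * (1 + norm x * norm y) powr N * inverse (real (Suc k) ^ 2)"
        unfolding T_def by (rule C(2)[OF _ inner_divide_norms_in_interval]) simp
      ultimately show "norm (T k y) \<le> C * (1 + norm x * R) powr N * inverse (real (Suc k) ^ 2)"
        by linarith
    next
      show "summable (\<lambda>k. C * (1 + norm x * R) powr N * inverse (real (Suc k) ^ 2))"
        by (intro summable_mult summable_inverse_Suc_squares)
    qed
    moreover have "continuous_on (ball 0 R) (T k)" for k
      unfolding T_def by (rule continuous_on_subset[OF continuous_on_deformed_kernel_term[OF assms(1) False] subset_UNIV])
    ultimately have "continuous_on (ball 0 R) (\<lambda>y. \<Sum>k. T k y)"
      by (intro uniform_limit_theorem) (auto intro!: always_eventually continuous_on_sum)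
    then show ?thesis
      using deformed_kernel_eq_series[OF assms(1) l, of x] by (simp add: T_def cong: continuous_on_cong)
  qed
  have "isCont (deformed_kernel a x) y" for y
    using cb[of "norm y + 1"] by (simp add: continuous_on_eq_continuous_at)
  then show ?thesis by (simp add: continuous_on_eq_continuous_at)
qed

lemma deformed_kernel_commute: "deformed_kernel a x y = deformed_kernel a y x"
  by (simp add: deformed_kernel_def Let_def inner_commute mult.commute disj_commute)

section \<open>The deformed Fourier transform\<close>

lemma measurable_deformed_kernel_left:
  fixes y :: "real ^ 'n"
  assumes "a > 0" and l: "CARD('n) = 2 * l + 2"
  shows "(\<lambda>x. deformed_kernel a x y) \<in> borel_measurable lebesgue"
proof -
  have "deformed_kernel a y \<in> borel_measurable borel"
    by (rule borel_measurable_continuous_onI[OF continuous_on_deformed_kernel[OF assms]])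
  then have "deformed_kernel a y \<in> borel_measurable lebesgue"
    by (intro measurable_completion) simp
  then show ?thesis by (simp add: deformed_kernel_commute[of a _ y])
qed

text \<open>
  For \<open>norm y \<le> R\<close>, \<open>1 + norm x * norm y \<le> (1 + R) * (1 + norm x)\<close> separates the two variables in the
  bound on the kernel. One integrable majorant thus serves a whole ball of \<open>y\<close>, which gives both
  integrability and, by dominated convergence, continuity.
\<close>

lemma deformed_fourier_well_defined_continuous:
  fixes f :: "real ^ 'n \<Rightarrow> complex"
  assumes "a > 0" "N \<ge> 0" "a * (real l + 3 / 2) - real l \<le> N" and l: "CARD('n) = 2 * l + 2"
    and f: "f \<in> borel_measurable lebesgue"
    and fin: "(\<integral>\<^sup>+ x. ennreal ((1 + norm x) powr N * norm (f x) * norm x powr (a - 2)) \<partial>lebesgue) < \<infinity>"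
  shows "integrable lebesgue (deformed_integrand a f y)"
    and "continuous_on UNIV (deformed_fourier a f)"
proof -
  define h where "h = (\<lambda>x :: real ^ 'n. (1 + norm x) powr N * norm (f x) * norm x powr (a - 2))"
  have w: "(\<lambda>x :: real ^ 'n. norm x powr c) \<in> borel_measurable lebesgue"
    "(\<lambda>x :: real ^ 'n. (1 + norm x) powr c) \<in> borel_measurable lebesgue" for c
    by (intro measurable_completion, simp)+
  have hm: "h \<in> borel_measurable lebesgue"
    unfolding h_def by (intro borel_measurable_times w measurable_compose[OF f borel_measurable_norm])
  have h: "integrable lebesgue h"
    by (rule integrableI_nonneg[OF hm]) (use fin in \<open>auto simp: h_def\<close>)
  have Im: "deformed_integrand a f y \<in> borel_measurable lebesgue" for y
    unfolding deformed_integrand_def[abs_def]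
    by (intro borel_measurable_times measurable_deformed_kernel_left[OF assms(1) l] f
        measurable_compose[OF w(1), of complex_of_real borel]) simp
  obtain C where C: "C \<ge> 0"
    "\<And>x y :: real ^ 'n. norm (deformed_kernel a x y) \<le> C * (1 + norm x * norm y) powr N"
    using norm_deformed_kernel_le[OF assms(1-3) l] by blast
  have bd: "norm (deformed_integrand a f y x) \<le> C * (1 + R) powr N * h x" if "norm y \<le> R" for R x y
  proof -
    have R: "R \<ge> 0" using that norm_ge_zero[of y] by linarith
    have "1 + norm x * norm y \<le> 1 + norm x * R" using that by (simp add: mult_left_mono)
    also have "\<dots> \<le> (1 + R) * (1 + norm x)" using R by (simp add: algebra_simps)
    finally have "(1 + norm x * norm y) powr N \<le> ((1 + R) * (1 + norm x)) powr N"
      using assms(2) by (intro powr_mono2) auto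
    also have "\<dots> = (1 + R) powr N * (1 + norm x) powr N" by (rule powr_mult)
    finally have "C * (1 + norm x * norm y) powr N \<le> C * ((1 + R) powr N * (1 + norm x) powr N)"
      using C(1) by (rule mult_left_mono)
    then have "norm (deformed_kernel a x y) \<le> C * ((1 + R) powr N * (1 + norm x) powr N)"
      using C(2)[of x y] by linarith
    then have "norm (deformed_kernel a x y) * (norm (f x) * norm x powr (a - 2))
        \<le> C * ((1 + R) powr N * (1 + norm x) powr N) * (norm (f x) * norm x powr (a - 2))"
      by (rule mult_right_mono) simp
    then show ?thesis by (simp add: deformed_integrand_def h_def norm_mult mult_ac)
  qed
  show "integrable lebesgue (deformed_integrand a f y)"
    by (rule Bochner_Integration.integrable_bound[OF integrable_mult_right[OF h, of "C * (1 + norm y) powr N"] Im])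
      (use bd[of y "norm y"] in \<open>auto intro!: AE_I2 order_trans[OF _ abs_ge_self]\<close>)
  have "(\<lambda>n. LINT x|lebesgue. deformed_integrand a f (Y n) x) \<longlonglongrightarrow> (LINT x|lebesgue. deformed_integrand a f y x)"
    if Y: "Y \<longlonglongrightarrow> y" for Y y
  proof -
    obtain R where R: "\<And>n. norm (Y n) \<le> R"
      using convergent_imp_Bseq[OF convergentI[OF Y]] by (auto simp: Bseq_def)
    show ?thesis
    proof (rule integral_dominated_convergence[where w = "\<lambda>x. C * (1 + R) powr N * h x"])
      show "AE x in lebesgue. (\<lambda>n. deformed_integrand a f (Y n) x) \<longlonglongrightarrow> deformed_integrand a f y x"
      proof (rule AE_I2)
        fix x
        have "isCont (deformed_kernel a x) y"
          using continuous_on_deformed_kernel[OF assms(1) l]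
          unfolding continuous_on_eq_continuous_at[OF open_UNIV] by blast
        then have "(\<lambda>n. deformed_kernel a x (Y n)) \<longlonglongrightarrow> deformed_kernel a x y"
          by (rule isCont_tendsto_compose[OF _ Y])
        then show "(\<lambda>n. deformed_integrand a f (Y n) x) \<longlonglongrightarrow> deformed_integrand a f y x"
          unfolding deformed_integrand_def by (intro tendsto_mult tendsto_const)
      qed
    qed (use h Im bd R in \<open>auto intro!: AE_I2\<close>)
  qed
  then have "continuous_on UNIV (\<lambda>y. LINT x|lebesgue. deformed_integrand a f y x)"
    unfolding continuous_on_sequentially comp_def by blast
  then show "continuous_on UNIV (deformed_fourier a f)"
    unfolding deformed_fourier_def[abs_def] Let_def by (intro continuous_on_mult continuous_on_const)
qed

theorem theorem3p5:
  fixes p q :: nat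
  assumes "p > 0" and "q > 0"
    and "CARD('n::finite) \<ge> 2" and "even CARD('n)"
  shows "\<forall>f \<in> (deformed_B p q :: (real ^ 'n \<Rightarrow> complex) set).
           (\<forall>y. integrable lebesgue (deformed_integrand (real p / real q) f y)) \<and>
           continuous_on UNIV (deformed_fourier (real p / real q) f)"
proof (intro ballI conjI allI)
  obtain l where l: "CARD('n) = 2 * l + 2"
  proof -
    obtain n where n: "CARD('n) = 2 * n" using assms(4) by (elim evenE)
    with assms(3) have "CARD('n) = 2 * (n - 1) + 2" by simp
    then show ?thesis using that by blast
  qed
  define a where "a = real p / real q"
  define N where "N = 3 * real CARD('n) * real p / 2 - real CARD('n) + 2"
  have a: "a > 0" "a \<le> real p" using assms by (simp_all add: a_def field_simps)
  have p: "real p \<ge> 1" using assms(1) by simp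
  \<comment> \<open>Bounding a by p reduces the condition on the exponent to \<open>l \<le> p (2 l + 3 / 2)\<close>.\<close>
  have lp: "real l \<le> real p * real l" using p by (simp add: mult_le_cancel_right1)
  have N: "N = 3 * real p * (real l + 1) - 2 * real l"
    by (simp add: N_def l algebra_simps)
  have "N \<ge> 0" using lp p by (simp add: N algebra_simps)
  have "a * (real l + 3 / 2) \<le> real p * (real l + 3 / 2)" using a by (intro mult_right_mono) auto
  then have aN: "a * (real l + 3 / 2) - real l \<le> N" using lp p by (simp add: N algebra_simps)
  fix f :: "real ^ 'n \<Rightarrow> complex" and y
  assume "f \<in> deformed_B p q"
  then have f: "f \<in> borel_measurable lebesgue"
    "(\<integral>\<^sup>+ x. ennreal ((1 + norm x) powr N * norm (f x) * norm x powr (a - 2)) \<partial>lebesgue) < \<infinity>"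
    by (auto simp: deformed_B_def N_def a_def intro: borel_measurable_integrable)
  show "integrable lebesgue (deformed_integrand (real p / real q) f y)"
    and "continuous_on UNIV (deformed_fourier (real p / real q) f)"
    using deformed_fourier_well_defined_continuous[OF a(1) \<open>N \<ge> 0\<close> aN l f] by (simp_all add: a_def)
qed

end
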